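(* Let $\Omega\subset\mathbb{R}^N$ ($N\ge2$) be a bounded domain with $C^3$ boundary $\Gamma$, and let $\beta_1<1$. Then there exists $s_1\in(0,s_0)$ such that for every $s\in(0,s_1)$, every function $p$ harmonic in $\Omega_s$, and every function $p_0$ that is constant on each connected component of $\Omega_s$, $$\beta_1\int_{\Omega_s}|(I-\vec n\vec n^t)\nabla p|^2\le\int_{\Omega_s}|\vec n\cdot\nabla p|^2+\frac{24}{s^2}\int_{\Omega_s}|p-p_0|^2,$$ where the integrals take values in $[0,\infty]$.
   Context: $\Phi(x)=\operatorname{dist}(x,\Gamma)$ for $x\in\Omega$, and $\Omega_s=\{x\in\Omega:\Phi(x)<s\}$. Since $\Gamma$ is $C^3$ and compact there is $s_0>0$ such that $\Phi$ is $C^3$ on $\Omega_{s_0}$ with $|\nabla\Phi|=1$ there; set $\vec n=-\nabla\Phi$ on $\Omega_{s_0}$ (a $C^2$ unit vector field extending the outward unit normal of $\Gamma$). $\vec n\vec n^t$ is the orthogonal projection onto $\vec n$, so $(I-\vec n\vec n^t)\vec a=\vec a-(\vec n\cdot\vec a)\vec n$. *)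

theory Defs
  imports "HOL-Analysis.Analysis"
begin

definition grad :: "('a::euclidean_space \<Rightarrow> real) \<Rightarrow> 'a \<Rightarrow> 'a" where
  "grad f x = (\<Sum>b\<in>Basis. frechet_derivative f (at x) b *\<^sub>R b)"

definition partial :: "'a::euclidean_space \<Rightarrow> ('a \<Rightarrow> real) \<Rightarrow> 'a \<Rightarrow> real" where
  "partial b f = (\<lambda>x. frechet_derivative f (at x) b)"

fun Ck_on :: "nat \<Rightarrow> 'a::euclidean_space set \<Rightarrow> ('a \<Rightarrow> real) \<Rightarrow> bool" where
  "Ck_on 0 U f = continuous_on U f"
| "Ck_on (Suc k) U f = (continuous_on U f \<and> f differentiable_on U \<and>
      (\<forall>b\<in>Basis. Ck_on k U (partial b f)))"

definition laplacian :: "('a::euclidean_space \<Rightarrow> real) \<Rightarrow> 'a \<Rightarrow> real" where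
  "laplacian f x = (\<Sum>b\<in>Basis. partial b (partial b f) x)"

definition harmonic_on :: "'a::euclidean_space set \<Rightarrow> ('a \<Rightarrow> real) \<Rightarrow> bool" where
  "harmonic_on U f \<longleftrightarrow> Ck_on 2 U f \<and> (\<forall>x\<in>U. laplacian f x = 0)"

definition Ck_boundary :: "nat \<Rightarrow> 'a::euclidean_space set \<Rightarrow> bool" where
  "Ck_boundary k \<Omega> \<longleftrightarrow> (\<forall>x\<in>frontier \<Omega>. \<exists>U \<psi>. open U \<and> x \<in> U \<and> Ck_on k U \<psi> \<and>
      (\<forall>y\<in>U. grad \<psi> y \<noteq> 0) \<and> \<Omega> \<inter> U = {y\<in>U. \<psi> y < 0})"

definition bdist :: "'a::euclidean_space set \<Rightarrow> 'a \<Rightarrow> real" where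
  "bdist \<Omega> x = infdist x (frontier \<Omega>)"

definition strip :: "'a::euclidean_space set \<Rightarrow> real \<Rightarrow> 'a set" where
  "strip \<Omega> s = {x\<in>\<Omega>. bdist \<Omega> x < s}"

text \<open>Extended outward normal n = - grad Phi.\<close>
definition nvec :: "'a::euclidean_space set \<Rightarrow> 'a \<Rightarrow> 'a" where
  "nvec \<Omega> x = - grad (bdist \<Omega>) x"

end

theory Submission
  imports Defs
begin

text \<open>Write \<open>\<Phi>\<close> for the distance to the boundary, \<open>\<nu> = grad \<Phi>\<close>, \<open>P = grad p\<close>, \<open>u = p - p0\<close>,
  \<open>N = (\<nu> \<bullet> P)\<^sup>2\<close> and \<open>T = norm P ^ 2 - N\<close>. Rellich's identity
  \<open>\<integral> g'(\<Phi>) (T - N) = - \<integral> g(\<Phi>) (norm P ^ 2 tr A - 2 A P \<bullet> P)\<close>, with \<open>A\<close> the Hessian of \<open>\<Phi>\<close>, says that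
  \<open>T - N\<close> has nearly the same integral over all level sets of \<open>\<Phi>\<close>, so over the thin strip its integral is,
  up to a factor \<open>c\<close>, the one weighted by a bump \<open>w(\<Phi>) = \<phi>(\<Phi>)\<^sup>2\<close> vanishing on both sides. The energy
  identity \<open>\<integral> w(\<Phi>) norm P ^ 2 = - \<integral> w'(\<Phi>) u (\<nu> \<bullet> P)\<close> and Young's inequality bound the
  latter by \<open>\<integral> \<phi>'(\<Phi>)\<^sup>2 u\<^sup>2 / 2\<close>; for \<open>\<phi>\<close> a parabola on an interval of length \<open>l\<close> this gives the
  constant \<open>15 / l\<^sup>2\<close>, which leaves room below \<open>24 / s\<^sup>2\<close>.
  All test functions have compact support in the open strip, since nothing is known about \<open>p\<close> at
  its boundary; the full strip is reached by Fatou's lemma.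
  The Hessian of \<open>\<Phi>\<close> is bounded up to the boundary because the boundary has interior and exterior
  tangent balls of a uniform radius \<open>r\<close>, whose distance functions touch \<open>\<Phi>\<close> from below and above.\<close>

section \<open>Functions of class \<open>C\<^sup>2\<close>\<close>

text \<open>The Hessian as a linear map, namely the derivative of \<open>grad f\<close> at
  \<open>x\<close> (see \<open>Ck2_grad_deriv\<close>). Its symmetry is a separate fact,
  \<open>Ck2_hess_symmetric\<close>.\<close>

definition hess :: "('a::euclidean_space \<Rightarrow> real) \<Rightarrow> 'a \<Rightarrow> 'a \<Rightarrow> 'a" where
  "hess f x h = (\<Sum>b\<in>Basis. frechet_derivative (partial b f) (at x) h *\<^sub>R b)"

lemma Ck_on_Suc_imp: "Ck_on (Suc k) U f \<Longrightarrow> Ck_on k U f"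
proof (induction k arbitrary: f)
  case (Suc k)
  have "\<forall>b\<in>Basis. Ck_on k U (partial b f)"
    by (intro ballI Suc.IH bspec[OF conjunct2[OF conjunct2[OF Suc.prems[unfolded Ck_on.simps(2)[of "Suc k"]]]]])
  thus ?case using Suc.prems unfolding Ck_on.simps(2)[of "Suc k"] Ck_on.simps(2)[of k] by blast
qed simp

lemma Ck_on_subset: "Ck_on k U f \<Longrightarrow> V \<subseteq> U \<Longrightarrow> Ck_on k V f"
  by (induction k arbitrary: f) (auto intro: continuous_on_subset differentiable_on_subset)

lemma Ck_on_3_imp_2: "Ck_on 3 U f \<Longrightarrow> Ck_on 2 U f"
  using Ck_on_Suc_imp[of 2 U f] by (simp add: eval_nat_numeral)

lemma frechet_derivative_expand:
  fixes f :: "'a::euclidean_space \<Rightarrow> real"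
  assumes "f differentiable (at x)"
  shows "frechet_derivative f (at x) h = (\<Sum>c\<in>Basis. (h \<bullet> c) * partial c f x)"
proof -
  have lin: "linear (frechet_derivative f (at x))"
    using assms by (rule linear_frechet_derivative)
  have "frechet_derivative f (at x) h = frechet_derivative f (at x) (\<Sum>c\<in>Basis. (h \<bullet> c) *\<^sub>R c)"
    by (simp add: euclidean_representation)
  also have "\<dots> = (\<Sum>c\<in>Basis. (h \<bullet> c) * partial c f x)"
    by (simp add: linear_sum[OF lin] linear_scale[OF lin] partial_def)
  finally show ?thesis .
qed

lemma has_derivative_grad:
  fixes f :: "'a::euclidean_space \<Rightarrow> real"
  assumes "f differentiable (at x)"
  shows "(f has_derivative (\<lambda>h. grad f x \<bullet> h)) (at x)"
proof -
  have "frechet_derivative f (at x) h = grad f x \<bullet> h" for h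
    unfolding frechet_derivative_expand[OF assms, of h] grad_def partial_def
    by (simp add: inner_sum_left inner_commute[of h] mult.commute)
  hence "frechet_derivative f (at x) = (\<lambda>h. grad f x \<bullet> h)" by (rule ext)
  thus ?thesis using iffD1[OF frechet_derivative_works assms] by metis
qed

lemma has_vector_derivative_along_line:
  assumes "(f has_derivative f') (at (y + a *\<^sub>R u))"
  shows "((\<lambda>a. f (y + a *\<^sub>R u)) has_vector_derivative f' u) (at a)"
proof -
  have "((\<lambda>a. y + a *\<^sub>R u) has_derivative (\<lambda>h. h *\<^sub>R u)) (at a)"
    by (auto intro!: derivative_eq_intros)
  from has_derivative_compose[OF this assms] show ?thesis
    using linear_scale[OF has_derivative_linear[OF assms]] by (simp add: has_vector_derivative_def)
qed

context
  fixes f :: "'a::euclidean_space \<Rightarrow> real" and U :: "'a set"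
  assumes openU: "open U" and C2: "Ck_on 2 U f"
begin

lemma Ck2_facts:
  shows "continuous_on U f"
    and "x \<in> U \<Longrightarrow> f differentiable (at x)"
    and "b \<in> Basis \<Longrightarrow> x \<in> U \<Longrightarrow> partial b f differentiable (at x)"
    and "b \<in> Basis \<Longrightarrow> continuous_on U (partial b f)"
    and "b \<in> Basis \<Longrightarrow> c \<in> Basis \<Longrightarrow> continuous_on U (partial c (partial b f))"
  using C2 by (auto simp: eval_nat_numeral differentiable_on_eq_differentiable_at[OF openU])

lemma Ck2_deriv: "x \<in> U \<Longrightarrow> (f has_derivative (\<lambda>h. grad f x \<bullet> h)) (at x)"
  by (intro has_derivative_grad Ck2_facts)

lemma Ck2_grad_deriv: "x \<in> U \<Longrightarrow> (grad f has_derivative hess f x) (at x)"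
proof -
  assume x: "x \<in> U"
  have "((\<lambda>x. \<Sum>b\<in>Basis. partial b f x *\<^sub>R b) has_derivative
     (\<lambda>h. \<Sum>b\<in>Basis. frechet_derivative (partial b f) (at x) h *\<^sub>R b)) (at x)"
    by (intro has_derivative_sum has_derivative_scaleR_left iffD1[OF frechet_derivative_works] Ck2_facts(3) x)
  thus ?thesis unfolding hess_def[abs_def] grad_def[abs_def] partial_def[abs_def] .
qed

lemma Ck2_hess_linear: "x \<in> U \<Longrightarrow> linear (hess f x)"
  by (rule has_derivative_linear[OF Ck2_grad_deriv])

lemma Ck2_hess_cont: "continuous_on U (\<lambda>x. hess f x v)"
proof -
  have "continuous_on U (\<lambda>x. \<Sum>b\<in>Basis. (\<Sum>c\<in>Basis. (v \<bullet> c) * partial c (partial b f) x) *\<^sub>R b)"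
    by (intro continuous_intros Ck2_facts)
  thus ?thesis
    by (rule continuous_on_eq) (simp add: hess_def frechet_derivative_expand[OF Ck2_facts(3)])
qed

lemma Ck2_grad_cont: "continuous_on U (grad f)"
proof -
  have "continuous_on U (\<lambda>x. \<Sum>b\<in>Basis. partial b f x *\<^sub>R b)"
    by (intro continuous_intros Ck2_facts)
  thus ?thesis by (simp add: grad_def[abs_def] partial_def)
qed

lemma laplacian_hess: "laplacian f x = (\<Sum>b\<in>Basis. hess f x b \<bullet> b)"
  by (simp add: laplacian_def hess_def partial_def inner_sum_left inner_Basis if_distrib
      cong: if_cong)

section \<open>Symmetry of the Hessian\<close>

text \<open>The mean value theorem is applied twice: along \<open>u\<close> to a difference of two
  parallel restrictions of \<open>f\<close>, then along \<open>v\<close> to \<open>grad f\<close> in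
  direction \<open>u\<close>. The second difference on the left is symmetric in \<open>u\<close> and
  \<open>v\<close>, which is the source of the symmetry of the Hessian.\<close>

lemma second_difference_mvt:
  assumes "0 < t" "\<And>a b. 0 \<le> a \<Longrightarrow> a \<le> t \<Longrightarrow> 0 \<le> b \<Longrightarrow> b \<le> t \<Longrightarrow> x + a *\<^sub>R u + b *\<^sub>R v \<in> U"
  shows "\<exists>a b. 0 < a \<and> a < t \<and> 0 < b \<and> b < t \<and>
    f (x + t *\<^sub>R u + t *\<^sub>R v) - f (x + t *\<^sub>R u) - (f (x + t *\<^sub>R v) - f x)
      = t * t * (hess f (x + a *\<^sub>R u + b *\<^sub>R v) v \<bullet> u)"
proof -
  let ?\<phi> = "\<lambda>a. f (x + a *\<^sub>R u + t *\<^sub>R v) - f (x + a *\<^sub>R u)"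
  let ?d = "\<lambda>a. (grad f (x + a *\<^sub>R u + t *\<^sub>R v) - grad f (x + a *\<^sub>R u)) \<bullet> u"
  have m: "x + a *\<^sub>R u + t *\<^sub>R v \<in> U" "x + a *\<^sub>R u \<in> U" if "0 \<le> a" "a \<le> t" for a
    using assms(2)[of a t] assms(2)[of a 0] that \<open>0 < t\<close> by auto
  have "(?\<phi> has_real_derivative ?d a) (at a)" if "0 \<le> a" "a \<le> t" for a
  proof -
    have *: "((\<lambda>a. f (y + a *\<^sub>R u)) has_real_derivative grad f (y + a *\<^sub>R u) \<bullet> u) (at a)"
      if "y + a *\<^sub>R u \<in> U" for y
      using has_vector_derivative_along_line[OF Ck2_deriv[OF that]]
      by (simp add: has_real_derivative_iff_has_vector_derivative)
    from DERIV_diff[OF *[of "x + t *\<^sub>R v"] *[of x]] m[OF that] show ?thesis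
      by (simp add: inner_diff_left add_ac)
  qed
  from MVT2[OF \<open>0 < t\<close> this] obtain a where a: "0 < a" "a < t" "?\<phi> t - ?\<phi> 0 = t * ?d a"
    by auto
  have m2: "x + a *\<^sub>R u + b *\<^sub>R v \<in> U" if "0 \<le> b" "b \<le> t" for b
    using assms(2)[of a b] a that by auto
  have "((\<lambda>b. grad f (x + a *\<^sub>R u + b *\<^sub>R v) \<bullet> u) has_real_derivative
      hess f (x + a *\<^sub>R u + b *\<^sub>R v) v \<bullet> u) (at b)" if "0 \<le> b" "b \<le> t" for b
  proof -
    have "((\<lambda>x. grad f x \<bullet> u) has_derivative (\<lambda>h. hess f (x + a *\<^sub>R u + b *\<^sub>R v) h \<bullet> u))
        (at (x + a *\<^sub>R u + b *\<^sub>R v))"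
      by (intro has_derivative_inner_left Ck2_grad_deriv m2 that)
    from has_vector_derivative_along_line[OF this] show ?thesis
      by (simp add: has_real_derivative_iff_has_vector_derivative)
  qed
  from MVT2[OF \<open>0 < t\<close> this] obtain b where b: "0 < b" "b < t"
    "?d a = t * (hess f (x + a *\<^sub>R u + b *\<^sub>R v) v \<bullet> u)"
    by (auto simp: inner_diff_left)
  show ?thesis using a b by (intro exI[of _ a] exI[of _ b]) auto
qed

text \<open>Divided by \<open>t * t\<close>, the second difference tends to a Hessian entry because
  the Hessian is continuous. Exchanging \<open>u\<close> and \<open>v\<close> leaves the quotient
  unchanged but transposes the entry.\<close>

lemma Ck2_hess_symmetric:
  assumes x: "x \<in> U"
  shows "hess f x v \<bullet> u = hess f x u \<bullet> v"
proof -
  obtain e where e: "e > 0" "ball x e \<subseteq> U" using openU x openE by blast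
  \<comment> \<open>\<open>R\<close> is symmetric in the two directions; the facts below are stated
    for any \<open>y\<close>, \<open>z\<close> with this sum of norms, so that they serve both
    orders.\<close>
  define R where "R = norm u + norm v + 1"
  have R: "R > 0" unfolding R_def by (smt (verit) norm_ge_zero)
  \<comment> \<open>The offset 2 makes \<open>t n * R < e\<close> strict already for
    \<open>n = 0\<close>, so every parallelogram used lies in the ball.\<close>
  define t where "t n = e / R / (2 + real n)" for n :: nat
  have tpos: "t n > 0" for n using e R by (auto simp: t_def)
  have small: "norm (a *\<^sub>R y + b *\<^sub>R z) \<le> t n * R"
    if "0 \<le> a" "a \<le> t n" "0 \<le> b" "b \<le> t n" "norm y + norm z + 1 = R" for a b n y z
  proof -
    have "norm (a *\<^sub>R y + b *\<^sub>R z) \<le> a * norm y + b * norm z"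
      using norm_triangle_ineq[of "a *\<^sub>R y" "b *\<^sub>R z"] that by auto
    also have "\<dots> \<le> t n * norm y + t n * norm z"
      using that by (intro add_mono mult_right_mono) auto
    also have "\<dots> \<le> t n * R" using tpos[of n] that(5)[symmetric] by (simp add: algebra_simps)
    finally show ?thesis .
  qed
  have tR: "t n * R < e" for n
  proof -
    have "t n * R = e / (2 + real n)" using R by (simp add: t_def)
    also have "\<dots> < e" using e by (simp add: field_simps add_pos_nonneg)
    finally show ?thesis .
  qed
  have inU: "x + a *\<^sub>R y + b *\<^sub>R z \<in> U"
    if "0 \<le> a" "a \<le> t n" "0 \<le> b" "b \<le> t n" "norm y + norm z + 1 = R" for a b n y z
  proof -
    have "dist (x + (a *\<^sub>R y + b *\<^sub>R z)) x < e"
      using small[OF that] tR[of n] by (simp add: dist_norm)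
    thus ?thesis using e by (auto simp: add.assoc dist_commute)
  qed
  have lim: "(\<lambda>n. (f (x + t n *\<^sub>R y + t n *\<^sub>R z) - f (x + t n *\<^sub>R y) - (f (x + t n *\<^sub>R z) - f x)) / (t n * t n))
      \<longlonglongrightarrow> hess f x z \<bullet> y" if R': "norm y + norm z + 1 = R" for y z
  proof -
    have "\<exists>a b. 0 < a \<and> a < t n \<and> 0 < b \<and> b < t n \<and>
      f (x + t n *\<^sub>R y + t n *\<^sub>R z) - f (x + t n *\<^sub>R y) - (f (x + t n *\<^sub>R z) - f x)
      = t n * t n * (hess f (x + a *\<^sub>R y + b *\<^sub>R z) z \<bullet> y)" for n
      by (rule second_difference_mvt[OF tpos]) (rule inU[OF _ _ _ _ R'])
    then have "\<forall>n. \<exists>a b. 0 < a \<and> a < t n \<and> 0 < b \<and> b < t n \<and>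
      f (x + t n *\<^sub>R y + t n *\<^sub>R z) - f (x + t n *\<^sub>R y) - (f (x + t n *\<^sub>R z) - f x)
      = t n * t n * (hess f (x + a *\<^sub>R y + b *\<^sub>R z) z \<bullet> y)" by blast
    from choice[OF this] obtain a where "\<forall>n. \<exists>b. 0 < a n \<and> a n < t n \<and> 0 < b \<and> b < t n \<and>
      f (x + t n *\<^sub>R y + t n *\<^sub>R z) - f (x + t n *\<^sub>R y) - (f (x + t n *\<^sub>R z) - f x)
      = t n * t n * (hess f (x + a n *\<^sub>R y + b *\<^sub>R z) z \<bullet> y)" ..
    from choice[OF this] obtain b where ab: "\<forall>n. 0 < a n \<and> a n < t n \<and> 0 < b n \<and> b n < t n \<and>
      f (x + t n *\<^sub>R y + t n *\<^sub>R z) - f (x + t n *\<^sub>R y) - (f (x + t n *\<^sub>R z) - f x)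
      = t n * t n * (hess f (x + a n *\<^sub>R y + b n *\<^sub>R z) z \<bullet> y)" ..
    have t0: "t \<longlonglongrightarrow> 0"
      unfolding t_def by (rule real_tendsto_divide_at_top[OF tendsto_const])
        (auto intro: filterlim_tendsto_add_at_top[OF tendsto_const] filterlim_real_sequentially)
    have "a \<longlonglongrightarrow> 0"
      by (rule tendsto_sandwich[OF _ _ tendsto_const t0]) (use ab in \<open>auto intro!: always_eventually less_imp_le\<close>)
    moreover have "b \<longlonglongrightarrow> 0"
      by (rule tendsto_sandwich[OF _ _ tendsto_const t0]) (use ab in \<open>auto intro!: always_eventually less_imp_le\<close>)
    ultimately have "(\<lambda>n. x + a n *\<^sub>R y + b n *\<^sub>R z) \<longlonglongrightarrow> x + 0 *\<^sub>R y + 0 *\<^sub>R z" by (intro tendsto_intros)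
    moreover have "isCont (\<lambda>x. hess f x z \<bullet> y) x"
      using Ck2_hess_cont[of z] x openU
      by (intro continuous_intros) (auto simp: continuous_on_eq_continuous_at)
    ultimately have "(\<lambda>n. hess f (x + a n *\<^sub>R y + b n *\<^sub>R z) z \<bullet> y) \<longlonglongrightarrow> hess f x z \<bullet> y"
      by (intro isCont_tendsto_compose[where g="\<lambda>x. hess f x z \<bullet> y"]) auto
    moreover have "(f (x + t n *\<^sub>R y + t n *\<^sub>R z) - f (x + t n *\<^sub>R y) - (f (x + t n *\<^sub>R z) - f x)) / (t n * t n)
      = hess f (x + a n *\<^sub>R y + b n *\<^sub>R z) z \<bullet> y" for n
      using ab[rule_format, of n] tpos[of n] by simp
    ultimately show ?thesis by simp
  qed
  have "(\<lambda>n. (f (x + t n *\<^sub>R u + t n *\<^sub>R v) - f (x + t n *\<^sub>R u) - (f (x + t n *\<^sub>R v) - f x)) / (t n * t n))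
      = (\<lambda>n. (f (x + t n *\<^sub>R v + t n *\<^sub>R u) - f (x + t n *\<^sub>R v) - (f (x + t n *\<^sub>R u) - f x)) / (t n * t n))"
    by (simp add: algebra_simps)
  with lim[of v u] have "(\<lambda>n. (f (x + t n *\<^sub>R u + t n *\<^sub>R v) - f (x + t n *\<^sub>R u) - (f (x + t n *\<^sub>R v) - f x)) / (t n * t n))
     \<longlonglongrightarrow> hess f x u \<bullet> v"
    by (simp add: R_def)
  moreover have "norm u + norm v + 1 = R" by (simp add: R_def)
  ultimately show ?thesis
    using LIMSEQ_unique[OF lim[of u v]] by blast
qed

end

section \<open>Integrals of compactly supported divergences\<close>

lemma set_integrable_compact_support:
  fixes f :: "'a::euclidean_space \<Rightarrow> real"
  assumes "compact K" "K \<subseteq> U" "continuous_on U f" "\<And>x. x \<in> U - K \<Longrightarrow> f x = 0"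
  shows "set_integrable lborel U f"
proof -
  have "integrable lborel (\<lambda>x. indicator K x *\<^sub>R f x)"
    using assms by (intro borel_integrable_compact) (auto intro: continuous_on_subset)
  moreover have "(\<lambda>x. indicator K x *\<^sub>R f x) = (\<lambda>x. indicator U x *\<^sub>R f x)"
    using assms(2,4) by (auto simp: indicator_def fun_eq_iff)
  ultimately show ?thesis by (simp add: set_integrable_def)
qed

text \<open>\<open>U\<close> and \<open>- K\<close> are open and cover the space, and both branches
  vanish on the overlap, so continuity can be glued.\<close>

lemma continuous_on_extend_zero:
  fixes f :: "'a::euclidean_space \<Rightarrow> 'b::real_normed_vector"
  assumes "compact K" "K \<subseteq> U" "open U" "continuous_on U f" "\<And>x. x \<in> U - K \<Longrightarrow> f x = 0"
  shows "continuous_on UNIV (\<lambda>x. if x \<in> U then f x else 0)"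
proof -
  have "continuous_on (U \<union> - K) (\<lambda>x. if x \<in> U then f x else 0)"
    using assms compact_imp_closed[OF \<open>compact K\<close>]
    by (intro continuous_on_cases_local_open) (auto intro!: open_subset open_Un)
  moreover have "U \<union> - K = UNIV" using assms(2) by auto
  ultimately show ?thesis by simp
qed

text \<open>The integral of \<open>f (x + t b)\<close> does not depend on \<open>t\<close>, so differentiating at \<open>t = 0\<close> gives the claim.\<close>

lemma integral_derivative_eq_0:
  fixes f :: "'a::euclidean_space \<Rightarrow> real"
  assumes K: "compact K" and der: "\<And>x. (f has_derivative f' x) (at x)"
    and cont: "continuous_on UNIV (\<lambda>x. f' x b)" and supp: "\<And>x. x \<notin> K \<Longrightarrow> f x = 0"
  shows "(\<integral>x. f' x b \<partial>lborel) = 0"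
proof -
  obtain R where R: "\<And>x. x \<in> K \<Longrightarrow> norm x \<le> R"
    using K by (meson bounded_iff compact_imp_bounded)
  have fcont: "continuous_on UNIV f"
    using has_derivative_continuous[OF der] by (auto intro!: continuous_at_imp_continuous_on)
  define S where "S = cball (0::'a) (R + norm b)"
  \<comment> \<open>For \<open>x\<close> in \<open>S\<close> the mean value point
    \<open>x + t *\<^sub>R b\<close> has \<open>t < h n \<le> 1\<close> and lies in this larger
    ball, so \<open>B\<close> bounds the difference quotients. Outside \<open>S\<close> both sample
    points miss \<open>K\<close> and the quotient is zero.\<close>
  obtain B where B: "\<And>x. x \<in> cball 0 (R + 2 * norm b) \<Longrightarrow> \<bar>f' x b\<bar> \<le> B"
  proof -
    have "compact ((\<lambda>x. f' x b) ` cball 0 (R + 2 * norm b))"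
      using cont by (intro compact_continuous_image continuous_on_subset[OF cont]) auto
    thus ?thesis using that by (fastforce dest: compact_imp_bounded simp: bounded_iff)
  qed
  define h where "h n = 1 / (1 + real n)" for n
  have h: "0 < h n" "h n \<le> 1" for n by (auto simp: h_def field_simps)
  have h0: "h \<longlonglongrightarrow> 0"
    unfolding h_def using LIMSEQ_inverse_real_of_nat by (simp add: inverse_eq_divide add.commute)
  define q where "q n x = (f (x + h n *\<^sub>R b) - f x) / h n" for n x
  have fint: "integrable lborel f"
    using set_integrable_compact_support[OF K, of UNIV f] fcont supp by (simp add: set_integrable_def)
  have shift: "integrable lborel (\<lambda>x. f (x + c))" "(\<integral>x. f (x + c) \<partial>lborel) = (\<integral>x. f x \<partial>lborel)" for c
  proof -
    have "integrable (distr lborel borel ((+) c)) f" using fint by (simp add: lborel_distr_plus)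
    thus "integrable lborel (\<lambda>x. f (x + c))"
      by (subst (asm) integrable_distr_eq) (auto simp: add.commute fcont borel_measurable_continuous_onI)
    have "(\<integral>x. f x \<partial>lborel) = (\<integral>x. f x \<partial>distr lborel borel ((+) c))" by (simp add: lborel_distr_plus)
    also have "\<dots> = (\<integral>x. f (c + x) \<partial>lborel)"
      by (rule integral_distr) (auto simp: fcont borel_measurable_continuous_onI)
    finally show "(\<integral>x. f (x + c) \<partial>lborel) = (\<integral>x. f x \<partial>lborel)" by (simp add: add.commute)
  qed
  have q0: "(\<integral>x. q n x \<partial>lborel) = 0" for n
    using shift fint by (simp add: q_def)
  have mvt: "\<exists>t. 0 < t \<and> t < h n \<and> q n x = f' (x + t *\<^sub>R b) b" for n x
  proof -
    have "((\<lambda>t. f (x + t *\<^sub>R b)) has_real_derivative f' (x + t *\<^sub>R b) b) (at t)" for t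
    proof -
      have "((\<lambda>t. f (x + t *\<^sub>R b)) has_derivative (\<lambda>t'. f' (x + t *\<^sub>R b) (t' *\<^sub>R b))) (at t)"
        by (rule has_derivative_compose[OF _ der]) (auto intro!: derivative_eq_intros)
      thus ?thesis
        using linear_scale[OF has_derivative_linear[OF der[of "x + t *\<^sub>R b"]], of _ b]
        by (simp add: has_field_derivative_def mult.commute[of _ "f' (x + t *\<^sub>R b) b"])
    qed
    from MVT2[OF h(1)[of n] this] show ?thesis
      using h[of n] by (auto simp: q_def)
  qed
  have lim: "(\<lambda>n. q n x) \<longlonglongrightarrow> f' x b" for x
  proof -
    have "\<exists>t. \<forall>n. 0 < t n \<and> t n < h n \<and> q n x = f' (x + t n *\<^sub>R b) b"
      using mvt by (intro choice) auto
    then obtain t where t: "\<And>n. 0 < t n" "\<And>n. t n < h n" "\<And>n. q n x = f' (x + t n *\<^sub>R b) b" by blast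
    have "t \<longlonglongrightarrow> 0"
      by (rule tendsto_sandwich[OF _ _ tendsto_const h0]) (use t in \<open>auto intro!: always_eventually less_imp_le\<close>)
    hence "(\<lambda>n. x + t n *\<^sub>R b) \<longlonglongrightarrow> x + 0 *\<^sub>R b" by (intro tendsto_intros)
    moreover have "isCont (\<lambda>x. f' x b) x" using cont by (simp add: continuous_on_eq_continuous_at)
    ultimately show ?thesis
      using isCont_tendsto_compose[of x "\<lambda>x. f' x b"] t(3) by simp
  qed
  have bound: "\<bar>q n x\<bar> \<le> indicator S x * B" for n x
  proof (cases "x \<in> S")
    case True
    obtain t where t: "0 < t" "t < h n" "q n x = f' (x + t *\<^sub>R b) b" using mvt by blast
    have "norm (x + t *\<^sub>R b) \<le> norm x + t * norm b"
      using norm_triangle_ineq[of x "t *\<^sub>R b"] t by simp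
    also have "\<dots> \<le> R + norm b + 1 * norm b"
      using True t h(2)[of n] by (intro add_mono mult_right_mono) (auto simp: S_def)
    finally show ?thesis using True B[of "x + t *\<^sub>R b"] t by simp
  next
    case False
    have "norm x \<le> norm (x + h n *\<^sub>R b) + h n * norm b"
      using norm_triangle_ineq4[of "x + h n *\<^sub>R b" "h n *\<^sub>R b"] h[of n] by simp
    also have "\<dots> \<le> norm (x + h n *\<^sub>R b) + 1 * norm b"
      using h[of n] by (intro add_mono mult_right_mono) auto
    finally have "x + h n *\<^sub>R b \<notin> K" using False R[of "x + h n *\<^sub>R b"] by (auto simp: S_def)
    moreover have "x \<notin> K" using False R[of x] norm_ge_zero[of b] by (auto simp: S_def)
    ultimately show ?thesis using False supp by (simp add: q_def)
  qed
  have meas: "q n \<in> borel_measurable lborel" for n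
  proof -
    have "continuous_on UNIV (\<lambda>x. f (x + h n *\<^sub>R b))"
      by (intro continuous_on_compose2[OF fcont] continuous_intros) auto
    hence "continuous_on UNIV (q n)" unfolding q_def[abs_def]
      using h(1)[of n] fcont by (intro continuous_intros) auto
    thus ?thesis by (simp add: borel_measurable_continuous_onI)
  qed
  have "(\<lambda>n. \<integral>x. q n x \<partial>lborel) \<longlonglongrightarrow> (\<integral>x. f' x b \<partial>lborel)"
  proof (rule integral_dominated_convergence[where w="\<lambda>x. indicator S x * B"])
    show "integrable lborel (\<lambda>x. indicator S x * B)"
      using borel_integrable_compact[of S "\<lambda>_. B"] by (simp add: S_def)
    show "(\<lambda>x. f' x b) \<in> borel_measurable lborel"
      using cont by (simp add: borel_measurable_continuous_onI)
  qed (use meas lim bound in auto)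
  thus ?thesis by (simp add: q0 LIMSEQ_const_iff)
qed

text \<open>Extended by zero, \<open>F\<close> is a differentiable field on the whole space with
  compact support. Each summand of its divergence is the derivative of one component along a fixed
  direction, to which \<open>integral_derivative_eq_0\<close> applies.\<close>

lemma divergence_integral_eq_0:
  fixes F :: "'a::euclidean_space \<Rightarrow> 'a"
  assumes U: "open U" and K: "compact K" "K \<subseteq> U"
    and der: "\<And>x. x \<in> U \<Longrightarrow> (F has_derivative F' x) (at x)"
    and cont: "\<And>b. continuous_on U (\<lambda>x. F' x b)"
    and supp: "\<And>x. x \<in> U - K \<Longrightarrow> F x = 0"
  shows "(LINT x:U|lborel. (\<Sum>b\<in>Basis. F' x b \<bullet> b)) = 0"
proof -
  define G where "G x = (if x \<in> U then F x else 0)" for x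
  define G' where "G' x = (if x \<in> U then F' x else (\<lambda>_. 0))" for x
  have clK: "open (- K)" using K by (simp add: compact_imp_closed open_Compl)
  have G0: "(G has_derivative (\<lambda>_. 0)) (at x)" if "x \<in> - K" for x
    by (rule has_derivative_transform_within_open[OF has_derivative_const[of 0] clK that])
       (use supp in \<open>auto simp: G_def\<close>)
  have derG: "(G has_derivative G' x) (at x)" for x
  proof (cases "x \<in> U")
    case True
    have "(G has_derivative F' x) (at x)"
      by (rule has_derivative_transform_within_open[OF der[OF True] U True]) (simp add: G_def)
    thus ?thesis using True by (simp add: G'_def)
  next
    case False
    thus ?thesis using G0[of x] K by (auto simp: G'_def)
  qed
  \<comment> \<open>The extension is zero on the open set \<open>- K\<close>, so uniqueness of the
    derivative forces \<open>F'\<close> to vanish there too.\<close>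
  have G'0: "F' x = (\<lambda>_. 0)" if "x \<in> U - K" for x
    using has_derivative_unique[OF derG[of x] G0[of x]] that by (auto simp: G'_def)
  have int: "set_integrable lborel U (\<lambda>x. F' x b \<bullet> b)" for b
    by (rule set_integrable_compact_support[OF K]) (use cont G'0 in \<open>auto intro!: continuous_intros\<close>)
  have "(\<integral>x. G' x b \<bullet> b \<partial>lborel) = 0" for b
  proof (rule integral_derivative_eq_0[OF K(1), where f="\<lambda>x. G x \<bullet> b" and f'="\<lambda>x h. G' x h \<bullet> b"])
    show "((\<lambda>x. G x \<bullet> b) has_derivative (\<lambda>h. G' x h \<bullet> b)) (at x)" for x
      using derG by (intro has_derivative_inner_left)
    have "continuous_on UNIV (\<lambda>x. if x \<in> U then F' x b \<bullet> b else 0)"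
      by (rule continuous_on_extend_zero[OF K U]) (use cont G'0 in \<open>auto intro!: continuous_intros\<close>)
    moreover have "(\<lambda>x. if x \<in> U then F' x b \<bullet> b else 0) = (\<lambda>x. G' x b \<bullet> b)"
      by (auto simp: G'_def)
    ultimately show "continuous_on UNIV (\<lambda>x. G' x b \<bullet> b)" by (simp only:)
    show "G x \<bullet> b = 0" if "x \<notin> K" for x using that supp by (auto simp: G_def)
  qed
  moreover have "(\<integral>x. G' x b \<bullet> b \<partial>lborel) = (LINT x:U|lborel. F' x b \<bullet> b)" for b
    unfolding set_lebesgue_integral_def
    by (intro Bochner_Integration.integral_cong) (auto simp: G'_def indicator_def)
  ultimately have "(\<Sum>b\<in>Basis. LINT x:U|lborel. F' x b \<bullet> b) = 0" by simp
  moreover have "(LINT x:U|lborel. (\<Sum>b\<in>Basis. F' x b \<bullet> b)) = (\<Sum>b\<in>Basis. LINT x:U|lborel. F' x b \<bullet> b)"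
    using int unfolding set_lebesgue_integral_def set_integrable_def scaleR_sum_right
    by (intro Bochner_Integration.integral_sum)
  ultimately show ?thesis by simp
qed

section \<open>Curvature of the level sets near the boundary\<close>

text \<open>At the minimum \<open>Q1 0 = 0\<close>. Were \<open>c\<close> negative,
  \<open>Q1\<close> would be negative just to the right of 0 and \<open>Q\<close> would drop below
  \<open>Q 0\<close>.\<close>

lemma second_derivative_nonneg_at_min:
  fixes Q :: "real \<Rightarrow> real"
  assumes d: "0 < d" and Q: "\<And>h. \<bar>h\<bar> < d \<Longrightarrow> (Q has_real_derivative Q1 h) (at h)"
    and min: "\<And>h. \<bar>h\<bar> < d \<Longrightarrow> Q 0 \<le> Q h" and Q1: "(Q1 has_real_derivative c) (at 0)"
  shows "0 \<le> c"
proof (rule ccontr)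
  assume "\<not> 0 \<le> c"
  have Q10: "Q1 0 = 0"
    using DERIV_local_min[OF Q[of 0] d] min d by auto
  from DERIV_neg_dec_right[OF Q1] \<open>\<not> 0 \<le> c\<close> obtain e where
    e: "e > 0" "\<And>h. 0 < h \<Longrightarrow> h < e \<Longrightarrow> Q1 h < 0"
    by (auto simp: Q10)
  define h where "h = min d e / 2"
  have h: "0 < h" "h < d" "h < e" using d e by (auto simp: h_def min_def)
  have "\<exists>\<xi>>0. \<xi> < h \<and> Q h - Q 0 = (h - 0) * Q1 \<xi>"
    using h by (intro MVT2 Q) auto
  then obtain \<xi> where \<xi>: "0 < \<xi>" "\<xi> < h" "Q h - Q 0 = h * Q1 \<xi>" by auto
  have "h * Q1 \<xi> < 0" using e(2)[of \<xi>] \<xi> h by (simp add: mult_pos_neg)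
  thus False using min[of h] \<xi> h by auto
qed

text \<open>The difference of the two squares is nonnegative near \<open>x\<close> and zero at
  \<open>x\<close>, so its second derivative along \<open>v\<close> is nonnegative there. Comparing
  squares instead of distances allows either sign of \<open>\<rho>\<close>: the exterior ball uses
  \<open>r\<close>, the interior one \<open>- r\<close>.\<close>

lemma touching_hessian_bound:
  fixes \<Phi> :: "'a::euclidean_space \<Rightarrow> real"
  assumes V: "open V" "x \<in> V"
    and \<Phi>: "\<And>y. y \<in> V \<Longrightarrow> (\<Phi> has_derivative (\<lambda>h. \<nu> y \<bullet> h)) (at y)"
    and \<nu>: "(\<nu> has_derivative A) (at x)"
    and le: "\<And>y. y \<in> V \<Longrightarrow> (\<Phi> y + \<rho>)\<^sup>2 \<le> (norm (y - z))\<^sup>2"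
    and eq: "(\<Phi> x + \<rho>)\<^sup>2 = (norm (x - z))\<^sup>2"
  shows "(\<Phi> x + \<rho>) * (A v \<bullet> v) \<le> (norm v)\<^sup>2"
proof -
  obtain e where e: "e > 0" "ball x e \<subseteq> V" using V openE by blast
  define d where "d = e / (norm v + 1)"
  have nv: "norm v + 1 > 0" by (smt (verit) norm_ge_zero)
  have d: "d > 0" using e nv by (simp add: d_def)
  have inV: "x + h *\<^sub>R v \<in> V" if "\<bar>h\<bar> < d" for h
  proof -
    have "\<bar>h\<bar> * norm v \<le> \<bar>h\<bar> * (norm v + 1)" by (intro mult_left_mono) auto
    also have "\<dots> < e" using that nv by (simp add: d_def pos_less_divide_eq)
    finally have "dist (x + h *\<^sub>R v) x < e" by (simp add: dist_norm)
    thus ?thesis using e by (auto simp: dist_commute)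
  qed
  define Q where "Q h = (x + h *\<^sub>R v - z) \<bullet> (x + h *\<^sub>R v - z) - (\<Phi> (x + h *\<^sub>R v) + \<rho>)\<^sup>2" for h
  define Q1 where "Q1 h = 2 * ((x + h *\<^sub>R v - z) \<bullet> v) - 2 * (\<Phi> (x + h *\<^sub>R v) + \<rho>) * (\<nu> (x + h *\<^sub>R v) \<bullet> v)" for h
  have \<Phi>': "((\<lambda>h. \<Phi> (x + h *\<^sub>R v)) has_real_derivative \<nu> (x + h *\<^sub>R v) \<bullet> v) (at h)" if "\<bar>h\<bar> < d" for h
    using has_vector_derivative_along_line[OF \<Phi>[OF inV[OF that]]]
    by (simp add: has_real_derivative_iff_has_vector_derivative)
  have \<nu>': "((\<lambda>h. \<nu> (x + h *\<^sub>R v) \<bullet> v) has_real_derivative A v \<bullet> v) (at 0)"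
    using has_vector_derivative_along_line[of "\<lambda>y. \<nu> y \<bullet> v" "\<lambda>h. A h \<bullet> v" x 0 v] has_derivative_inner_left[OF \<nu>, of v]
    by (simp add: has_real_derivative_iff_has_vector_derivative)
  have lin: "((\<lambda>h. (x + h *\<^sub>R v - z) \<bullet> w) has_real_derivative v \<bullet> w) (at h)" for h w
    by (auto intro!: derivative_eq_intros simp: inner_diff_left inner_add_left)
  have quad: "((\<lambda>h. (x + h *\<^sub>R v - z) \<bullet> (x + h *\<^sub>R v - z)) has_real_derivative 2 * ((x + h *\<^sub>R v - z) \<bullet> v)) (at h)" for h
    unfolding inner_diff_left inner_diff_right inner_add_left inner_add_right inner_scaleR_left inner_scaleR_right
    by (auto intro!: derivative_eq_intros simp: inner_commute algebra_simps)
  have "0 \<le> 2 * (v \<bullet> v) - 2 * ((\<nu> x \<bullet> v)\<^sup>2 + (\<Phi> x + \<rho>) * (A v \<bullet> v))"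
  proof (rule second_derivative_nonneg_at_min[OF d, of Q Q1])
    show "(Q has_real_derivative Q1 h) (at h)" if "\<bar>h\<bar> < d" for h
      unfolding Q_def[abs_def] Q1_def
      by (rule derivative_eq_intros quad \<Phi>'[OF that] refl)+ (simp add: algebra_simps)
    show "Q 0 \<le> Q h" if "\<bar>h\<bar> < d" for h
      using le[OF inV[OF that]] eq by (simp add: Q_def power2_norm_eq_inner)
    show "(Q1 has_real_derivative 2 * (v \<bullet> v) - 2 * ((\<nu> x \<bullet> v)\<^sup>2 + (\<Phi> x + \<rho>) * (A v \<bullet> v))) (at 0)"
      unfolding Q1_def[abs_def]
      by (rule DERIV_cong[OF DERIV_diff[OF DERIV_cmult[OF lin]
            DERIV_mult[OF DERIV_cmult[OF DERIV_add[OF \<Phi>'[of 0] DERIV_const]] \<nu>']]])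
         (use d in \<open>auto simp: algebra_simps power2_eq_square\<close>)
  qed
  \<comment> \<open>Here \<open>b\<close> stands for the square of
    \<open>\<nu> x \<bullet> v\<close>, which has the favourable sign and is dropped.\<close>
  moreover have "c \<le> a" if "0 \<le> 2 * a - 2 * (b + c)" "0 \<le> b" for a b c :: real
    using that by simp
  ultimately show ?thesis
    unfolding power2_norm_eq_inner using zero_le_power2[of "\<nu> x \<bullet> v"] by blast
qed

section \<open>Interior and exterior tangent balls of uniform radius\<close>

text \<open>The Hessian is bounded on a compact ball, so the gradient is Lipschitz there and the
  mean value theorem along segments gives a quadratic remainder. The constants do not depend on
  \<open>q\<close>, as is required for one radius to serve all boundary points near
  \<open>q0\<close>.\<close>

lemma Ck2_local_quadratic_bound:
  fixes \<psi> :: "'a::euclidean_space \<Rightarrow> real"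
  assumes U: "open U" "Ck_on 2 U \<psi>" "q0 \<in> U" and g0: "grad \<psi> q0 \<noteq> 0"
  obtains \<rho> K m where "\<rho> > 0" "K \<ge> 0" "m > 0" "ball q0 (2 * \<rho>) \<subseteq> U"
    "\<And>q. q \<in> ball q0 \<rho> \<Longrightarrow> m \<le> norm (grad \<psi> q)"
    "\<And>q h. q \<in> ball q0 \<rho> \<Longrightarrow> norm h < \<rho> \<Longrightarrow>
       \<bar>\<psi> (q + h) - \<psi> q - grad \<psi> q \<bullet> h\<bar> \<le> K * (norm h)\<^sup>2"
proof -
  obtain e where e: "e > 0" "cball q0 e \<subseteq> U" using U open_contains_cball by blast
  have "isCont (grad \<psi>) q0"
    using Ck2_grad_cont[OF U(1,2)] U by (simp add: continuous_on_eq_continuous_at)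
  then obtain d where d: "d > 0" "\<And>q. dist q q0 < d \<Longrightarrow> dist (grad \<psi> q) (grad \<psi> q0) < norm (grad \<psi> q0) / 2"
    using g0 unfolding continuous_at_eps_delta by (metis zero_less_norm_iff half_gt_zero)
  \<comment> \<open>Half of \<open>e\<close> leaves room for \<open>q + h\<close> when
    \<open>q - q0\<close> and \<open>h\<close> are both shorter than \<open>\<rho>\<close>.\<close>
  define \<rho> where "\<rho> = min d (e / 2)"
  have \<rho>: "\<rho> > 0" "\<rho> \<le> d" "2 * \<rho> \<le> e" using d e by (auto simp: \<rho>_def)
  have "compact ((\<lambda>y. \<Sum>b\<in>Basis. norm (hess \<psi> y b)) ` cball q0 e)"
    by (intro compact_continuous_image continuous_intros continuous_on_subset[OF Ck2_hess_cont[OF U(1,2)]])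
       (use e in auto)
  then obtain K0 where K0: "\<And>y. y \<in> cball q0 e \<Longrightarrow> \<bar>\<Sum>b\<in>Basis. norm (hess \<psi> y b)\<bar> \<le> K0"
    using compact_imp_bounded by (fastforce simp: bounded_iff)
  define K where "K = max K0 0"
  have onK: "onorm (hess \<psi> y) \<le> K" if "y \<in> cball q0 e" for y
  proof (rule onorm_le)
    fix h
    have lin: "linear (hess \<psi> y)" using Ck2_hess_linear[OF U(1,2)] e that by auto
    have "hess \<psi> y h = hess \<psi> y (\<Sum>b\<in>Basis. (h \<bullet> b) *\<^sub>R b)" by (simp add: euclidean_representation)
    also have "\<dots> = (\<Sum>b\<in>Basis. (h \<bullet> b) *\<^sub>R hess \<psi> y b)" by (simp add: linear_sum[OF lin] linear_scale[OF lin])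
    finally have "norm (hess \<psi> y h) \<le> (\<Sum>b\<in>Basis. norm ((h \<bullet> b) *\<^sub>R hess \<psi> y b))"
      by (metis norm_sum)
    also have "\<dots> \<le> (\<Sum>b\<in>Basis. norm h * norm (hess \<psi> y b))"
      by (intro sum_mono) (auto intro!: mult_right_mono Basis_le_norm)
    also have "\<dots> = (\<Sum>b\<in>Basis. norm (hess \<psi> y b)) * norm h" by (simp add: sum_distrib_left mult.commute)
    also have "\<dots> \<le> K * norm h" using K0[OF that] by (intro mult_right_mono) (auto simp: K_def)
    finally show "norm (hess \<psi> y h) \<le> K * norm h" .
  qed
  have lip: "norm (grad \<psi> y - grad \<psi> q) \<le> K * norm (y - q)" if "y \<in> cball q0 e" "q \<in> cball q0 e" for y q
  proof (rule differentiable_bound[OF convex_cball _ _ that])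
    fix w assume w: "w \<in> cball q0 e"
    show "onorm (hess \<psi> w) \<le> K" by (rule onK[OF w])
    have "w \<in> U" using w e by blast
    thus "(grad \<psi> has_derivative hess \<psi> w) (at w within cball q0 e)"
      by (rule has_derivative_at_withinI[OF Ck2_grad_deriv[OF U(1,2)]])
  qed
  show ?thesis
  proof (rule that[of \<rho> K "norm (grad \<psi> q0) / 2"])
    show "\<rho> > 0" "K \<ge> 0" "norm (grad \<psi> q0) / 2 > 0" "ball q0 (2 * \<rho>) \<subseteq> U"
      using \<rho> e g0 by (auto simp: K_def)
    show "norm (grad \<psi> q0) / 2 \<le> norm (grad \<psi> q)" if "q \<in> ball q0 \<rho>" for q
    proof -
      have "norm (grad \<psi> q - grad \<psi> q0) < norm (grad \<psi> q0) / 2"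
        using d(2)[of q] that \<rho> by (simp add: dist_commute) (simp add: dist_norm norm_minus_commute)
      thus ?thesis using norm_triangle_ineq2[of "grad \<psi> q0" "grad \<psi> q"] by (simp add: norm_minus_commute)
    qed
    show "\<bar>\<psi> (q + h) - \<psi> q - grad \<psi> q \<bullet> h\<bar> \<le> K * (norm h)\<^sup>2" if q: "q \<in> ball q0 \<rho>" and h: "norm h < \<rho>" for q h
    proof -
      have inb: "q + t *\<^sub>R h \<in> cball q0 e" if "0 \<le> t" "t \<le> 1" for t
      proof -
        have "norm (t *\<^sub>R h) \<le> 1 * norm h" using that by (simp add: mult_left_le_one_le)
        moreover have "dist q0 (q + t *\<^sub>R h) \<le> dist q0 q + norm (t *\<^sub>R h)"
          using dist_triangle[of q0 "q + t *\<^sub>R h" q] by (simp add: dist_norm)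
        ultimately show ?thesis using q h \<rho> by auto
      qed
      have "((\<lambda>t. \<psi> (q + t *\<^sub>R h)) has_real_derivative grad \<psi> (q + t *\<^sub>R h) \<bullet> h) (at t)" if "0 \<le> t" "t \<le> 1" for t
        using has_vector_derivative_along_line[OF Ck2_deriv[OF U(1,2)], of q t h] inb[OF that] e
        by (auto simp: has_real_derivative_iff_has_vector_derivative)
      from MVT2[OF _ this, of 0 1] obtain t where t: "0 < t" "t < 1"
        "\<psi> (q + h) - \<psi> q = grad \<psi> (q + t *\<^sub>R h) \<bullet> h" by auto
      have "\<bar>\<psi> (q + h) - \<psi> q - grad \<psi> q \<bullet> h\<bar> = \<bar>(grad \<psi> (q + t *\<^sub>R h) - grad \<psi> q) \<bullet> h\<bar>"
        using t by (simp add: inner_diff_left)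
      also have "\<dots> \<le> norm (grad \<psi> (q + t *\<^sub>R h) - grad \<psi> q) * norm h" by (rule Cauchy_Schwarz_ineq2)
      also have "\<dots> \<le> (K * norm (t *\<^sub>R h)) * norm h"
        using lip[OF inb[of t] inb[of 0]] t by (intro mult_right_mono) auto
      also have "\<dots> \<le> (K * norm h) * norm h"
        using t by (intro mult_right_mono mult_left_mono) (auto simp: K_def mult_left_le_one_le)
      finally show ?thesis by (simp add: power2_eq_square)
    qed
  qed
qed

text \<open>By the triangle inequality, since the centres are \<open>r - r'\<close> apart. It
  permits lowering the radii to a common minimum.\<close>

lemma tangent_ball_mono:
  fixes q e :: "'a::euclidean_space"
  assumes "norm e = 1" "0 < r'" "r' \<le> r"
  shows "ball (q + r' *\<^sub>R e) r' \<subseteq> ball (q + r *\<^sub>R e) r"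
    and "ball (q - r' *\<^sub>R e) r' \<subseteq> ball (q - r *\<^sub>R e) r"
proof -
  have "(q + r *\<^sub>R e) - (q + r' *\<^sub>R e) = (r - r') *\<^sub>R e" "(q - r *\<^sub>R e) - (q - r' *\<^sub>R e) = - ((r - r') *\<^sub>R e)"
    by (auto simp: algebra_simps)
  hence d: "dist (q + r *\<^sub>R e) (q + r' *\<^sub>R e) = r - r'" "dist (q - r *\<^sub>R e) (q - r' *\<^sub>R e) = r - r'"
    using assms unfolding dist_norm by simp_all
  have "dist c x < r" if "dist c c' = r - r'" "dist c' x < r'" for c c' x :: 'a
    using dist_triangle[of c x c'] that by simp
  from this[OF d(1)] this[OF d(2)] show "ball (q + r' *\<^sub>R e) r' \<subseteq> ball (q + r *\<^sub>R e) r"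
    "ball (q - r' *\<^sub>R e) r' \<subseteq> ball (q - r *\<^sub>R e) r"
    by (simp_all add: subset_eq)
qed

text \<open>The normal \<open>e\<close> is the normalised gradient of a local defining function
  \<open>\<psi>\<close>. A displacement \<open>h\<close> into a tangent ball of radius
  \<open>r\<close> has squared norm below \<open>2 * r\<close> times its normal component, so for
  small \<open>r\<close> the linear term of \<open>\<psi>\<close> outweighs the quadratic remainder
  and fixes the sign of \<open>\<psi>\<close>.\<close>

lemma local_tangent_balls:
  fixes \<Omega> :: "'a::euclidean_space set"
  assumes "open \<Omega>" and C: "Ck_boundary 3 \<Omega>" and q0: "q0 \<in> frontier \<Omega>"
  shows "\<exists>\<rho> r. 0 < \<rho> \<and> 0 < r \<and> (\<forall>q\<in>frontier \<Omega> \<inter> ball q0 \<rho>. \<exists>e. norm e = 1 \<and>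
    ball (q + r *\<^sub>R e) r \<inter> \<Omega> = {} \<and> ball (q - r *\<^sub>R e) r \<subseteq> \<Omega>)"
proof -
  obtain U \<psi> where U: "open U" "q0 \<in> U" "Ck_on 3 U \<psi>" "\<And>y. y \<in> U \<Longrightarrow> grad \<psi> y \<noteq> 0"
    "\<Omega> \<inter> U = {y \<in> U. \<psi> y < 0}"
    using bspec[OF C[unfolded Ck_boundary_def] q0] by (elim exE conjE) metis
  have in\<Omega>: "y \<in> \<Omega> \<longleftrightarrow> \<psi> y < 0" if "y \<in> U" for y
    using U(5) that by (metis (mono_tags, lifting) IntE IntI mem_Collect_eq)
  note C2 = Ck_on_3_imp_2[OF U(3)]
  obtain \<rho> K m where \<rho>: "\<rho> > 0" "K \<ge> 0" "m > 0" "ball q0 (2 * \<rho>) \<subseteq> U"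
    and gm: "\<And>q. q \<in> ball q0 \<rho> \<Longrightarrow> m \<le> norm (grad \<psi> q)"
    and taylor: "\<And>q h. q \<in> ball q0 \<rho> \<Longrightarrow> norm h < \<rho> \<Longrightarrow>
       \<bar>\<psi> (q + h) - \<psi> q - grad \<psi> q \<bullet> h\<bar> \<le> K * (norm h)\<^sup>2"
    using Ck2_local_quadratic_bound[OF U(1) C2 U(2) U(4)[OF U(2)]] by metis
  \<comment> \<open>The first bound keeps the balls within the range of the expansion, the second
    makes the gradient dominate the remainder; \<open>K + 1\<close> avoids division by zero.\<close>
  define r where "r = min (\<rho> / 2) (m / (2 * (K + 1)))"
  have r: "0 < r" "2 * r \<le> \<rho>" "2 * r * K \<le> m"
  proof -
    show "0 < r" "2 * r \<le> \<rho>" using \<rho> by (auto simp: r_def)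
    have "2 * r * K \<le> 2 * (m / (2 * (K + 1))) * K"
      using \<rho> by (intro mult_right_mono mult_left_mono) (auto simp: r_def)
    also have "\<dots> \<le> m" using \<rho> by (simp add: field_simps)
    finally show "2 * r * K \<le> m" .
  qed
  have "\<exists>e. norm e = 1 \<and> ball (q + r *\<^sub>R e) r \<inter> \<Omega> = {} \<and> ball (q - r *\<^sub>R e) r \<subseteq> \<Omega>"
    if q: "q \<in> frontier \<Omega>" "q \<in> ball q0 \<rho>" for q
  proof -
    define g where "g = norm (grad \<psi> q)"
    define e where "e = grad \<psi> q /\<^sub>R g"
    have g: "m \<le> g" "g > 0" using gm[OF q(2)] \<rho> by (auto simp: g_def)
    have e1: "norm e = 1" using g by (simp add: e_def g_def)
    have ge: "grad \<psi> q = g *\<^sub>R e" using g by (simp add: e_def)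
    have qU: "q \<in> U" using q \<rho> by auto
    have "q \<notin> \<Omega>" using q \<open>open \<Omega>\<close> by (auto simp: frontier_def interior_open)
    hence "\<psi> q \<ge> 0" using in\<Omega>[OF qU] by simp
    \<comment> \<open>A positive value would persist on a neighbourhood of \<open>q\<close>, which
      meets \<open>\<Omega>\<close>, where \<open>\<psi>\<close> is negative.\<close>
    moreover have "\<not> \<psi> q > 0"
    proof
      assume pos: "\<psi> q > 0"
      have "open (U \<inter> \<psi> -` {0<..})"
        using Ck2_facts(1)[OF U(1) C2] U(1) by (intro continuous_open_preimage) auto
      moreover have "q \<in> closure \<Omega>" using q by (simp add: frontier_def)
      ultimately obtain y where "y \<in> \<Omega>" "y \<in> U \<inter> \<psi> -` {0<..}"
        using qU pos open_Int_closure_eq_empty[of "U \<inter> \<psi> -` {0<..}" \<Omega>] by blast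
      thus False using in\<Omega>[of y] by simp
    qed
    ultimately have \<psi>0: "\<psi> q = 0" by simp
    \<comment> \<open>The sign \<open>\<sigma>\<close> treats both balls at once: 1 for the
      exterior, -1 for the interior one.\<close>
    have key: "y \<in> U \<and> 0 < \<sigma> * \<psi> y"
      if y: "y \<in> ball (q + (\<sigma> * r) *\<^sub>R e) r" and \<sigma>: "\<sigma> = 1 \<or> \<sigma> = -1" for y \<sigma>
    proof -
      define h where "h = y - q"
      have yh: "y = q + h" by (simp add: h_def)
      have "norm (h - (\<sigma> * r) *\<^sub>R e) < r" using y by (simp add: h_def dist_norm norm_minus_commute algebra_simps)
      hence "(norm (h - (\<sigma> * r) *\<^sub>R e))\<^sup>2 < r\<^sup>2" using r by (intro power_strict_mono) auto
      also have "(norm (h - (\<sigma> * r) *\<^sub>R e))\<^sup>2 = (norm h)\<^sup>2 - 2 * r * (\<sigma> * (e \<bullet> h)) + r\<^sup>2"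
      proof -
        have "e \<bullet> e = 1" using e1 by (simp add: norm_eq_1)
        hence "(norm (h - c *\<^sub>R e))\<^sup>2 = (norm h)\<^sup>2 - 2 * c * (e \<bullet> h) + c\<^sup>2" for c
          unfolding power2_norm_eq_inner power2_eq_square[of c]
          by (simp add: inner_diff_left inner_diff_right inner_commute algebra_simps)
        moreover have "(\<sigma> * r)\<^sup>2 = r\<^sup>2" using \<sigma> by auto
        ultimately show ?thesis by simp
      qed
      finally have hh: "(norm h)\<^sup>2 < 2 * r * (\<sigma> * (e \<bullet> h))" by simp
      hence "0 < 2 * r * (\<sigma> * (e \<bullet> h))" using zero_le_power2[of "norm h"] by linarith
      hence seh: "0 < \<sigma> * (e \<bullet> h)" by (rule zero_less_mult_pos) (use r in simp)
      have "norm h < 2 * r"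
      proof -
        have "norm h \<le> norm (h - (\<sigma> * r) *\<^sub>R e) + norm ((\<sigma> * r) *\<^sub>R e)"
          using norm_triangle_ineq[of "h - (\<sigma> * r) *\<^sub>R e" "(\<sigma> * r) *\<^sub>R e"] by simp
        also have "norm ((\<sigma> * r) *\<^sub>R e) = r" using \<sigma> e1 r by auto
        finally show ?thesis using \<open>norm (h - (\<sigma> * r) *\<^sub>R e) < r\<close> by simp
      qed
      hence h\<rho>: "norm h < \<rho>" using r by simp
      have "dist q0 y \<le> dist q0 q + norm h"
        using dist_triangle[of q0 y q] by (simp add: h_def dist_norm norm_minus_commute)
      hence yU: "y \<in> U" using q h\<rho> \<rho> by auto
      have "\<bar>\<psi> y - g * (e \<bullet> h)\<bar> \<le> K * (norm h)\<^sup>2"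
        using taylor[OF q(2) h\<rho>] by (simp add: yh \<psi>0 ge)
      hence "\<sigma> * \<psi> y \<ge> g * (\<sigma> * (e \<bullet> h)) - K * (norm h)\<^sup>2"
        using \<sigma> by (auto simp: abs_le_iff)
      moreover have "g * (\<sigma> * (e \<bullet> h)) \<ge> m * (\<sigma> * (e \<bullet> h))" using g seh by (intro mult_right_mono) auto
      moreover have mK: "m * (\<sigma> * (e \<bullet> h)) \<ge> (2 * r * K) * (\<sigma> * (e \<bullet> h))" using r seh by (intro mult_right_mono) auto
      moreover have "K * (norm h)\<^sup>2 < m * (\<sigma> * (e \<bullet> h))"
      \<comment> \<open>The strictness of \<open>hh\<close> survives multiplication by
        \<open>K\<close> only if \<open>K\<close> is positive; for \<open>K = 0\<close> the right
        side is positive by itself.\<close>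
      proof (cases "K = 0")
        case False
        hence "K * (norm h)\<^sup>2 < K * (2 * r * (\<sigma> * (e \<bullet> h)))"
          using \<rho> hh by (intro mult_strict_left_mono) auto
        also have "\<dots> = (2 * r * K) * (\<sigma> * (e \<bullet> h))" by simp
        finally show ?thesis using mK by linarith
      qed (use \<rho> seh in auto)
      ultimately show ?thesis using yU by linarith
    qed
    have "ball (q + r *\<^sub>R e) r \<inter> \<Omega> = {}"
    proof -
      have "y \<notin> \<Omega>" if "y \<in> ball (q + r *\<^sub>R e) r" for y
        using key[of y 1] that in\<Omega>[of y] by simp
      thus ?thesis by blast
    qed
    moreover have "ball (q - r *\<^sub>R e) r \<subseteq> \<Omega>"
    proof
      fix y assume "y \<in> ball (q - r *\<^sub>R e) r"
      thus "y \<in> \<Omega>" using key[of y "-1"] in\<Omega>[of y] by simp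
    qed
    ultimately show ?thesis using e1 by blast
  qed
  thus ?thesis using r \<rho> by (intro exI[of _ \<rho>] exI[of _ r]) auto
qed

text \<open>Finitely many of the neighbourhoods from \<open>local_tangent_balls\<close> cover the
  compact boundary, and the smallest of their ball radii serves everywhere.\<close>

lemma uniform_tangent_balls:
  fixes \<Omega> :: "'a::euclidean_space set"
  assumes "open \<Omega>" "bounded \<Omega>" "Ck_boundary 3 \<Omega>"
  obtains r where "0 < r" "\<And>q. q \<in> frontier \<Omega> \<Longrightarrow> \<exists>e. norm e = 1 \<and>
    ball (q + r *\<^sub>R e) r \<inter> \<Omega> = {} \<and> ball (q - r *\<^sub>R e) r \<subseteq> \<Omega>"
proof -
  have comp: "compact (frontier \<Omega>)" using assms by (simp add: compact_frontier_bounded)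
  \<comment> \<open>A pair holds the radius of the neighbourhood and the radius of the balls, so
    that a single use of choice selects both.\<close>
  have "\<forall>q0. \<exists>p. q0 \<in> frontier \<Omega> \<longrightarrow> 0 < fst p \<and> 0 < snd p \<and>
    (\<forall>q\<in>frontier \<Omega> \<inter> ball q0 (fst p). \<exists>e. norm e = 1 \<and>
    ball (q + snd p *\<^sub>R e) (snd p) \<inter> \<Omega> = {} \<and> ball (q - snd p *\<^sub>R e) (snd p) \<subseteq> \<Omega>)"
  proof
    fix q0
    show "\<exists>p. q0 \<in> frontier \<Omega> \<longrightarrow> 0 < fst p \<and> 0 < snd p \<and>
    (\<forall>q\<in>frontier \<Omega> \<inter> ball q0 (fst p). \<exists>e. norm e = 1 \<and>
    ball (q + snd p *\<^sub>R e) (snd p) \<inter> \<Omega> = {} \<and> ball (q - snd p *\<^sub>R e) (snd p) \<subseteq> \<Omega>)"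
    proof (cases "q0 \<in> frontier \<Omega>")
      case True
      then obtain \<rho> r where "0 < \<rho> \<and> 0 < r \<and> (\<forall>q\<in>frontier \<Omega> \<inter> ball q0 \<rho>. \<exists>e. norm e = 1 \<and>
        ball (q + r *\<^sub>R e) r \<inter> \<Omega> = {} \<and> ball (q - r *\<^sub>R e) r \<subseteq> \<Omega>)"
        using local_tangent_balls[OF assms(1,3) True] by (elim exE)
      thus ?thesis by (intro exI[of _ "(\<rho>, r)"] impI, unfold fst_conv snd_conv)
    qed (intro exI impI, simp)
  qed
  from choice[OF this] obtain p where p: "\<forall>q0. q0 \<in> frontier \<Omega> \<longrightarrow> 0 < fst (p q0) \<and> 0 < snd (p q0) \<and>
    (\<forall>q\<in>frontier \<Omega> \<inter> ball q0 (fst (p q0)). \<exists>e. norm e = 1 \<and>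
    ball (q + snd (p q0) *\<^sub>R e) (snd (p q0)) \<inter> \<Omega> = {} \<and> ball (q - snd (p q0) *\<^sub>R e) (snd (p q0)) \<subseteq> \<Omega>)" ..
  obtain D where D: "D \<subseteq> frontier \<Omega>" "finite D" "frontier \<Omega> \<subseteq> (\<Union>q0\<in>D. ball q0 (fst (p q0)))"
  proof (rule compactE_image[OF comp, of "frontier \<Omega>" "\<lambda>q0. ball q0 (fst (p q0))"])
    show "frontier \<Omega> \<subseteq> (\<Union>q0\<in>frontier \<Omega>. ball q0 (fst (p q0)))"
    proof
      fix x assume x: "x \<in> frontier \<Omega>"
      hence "0 < fst (p x)" using p by blast
      thus "x \<in> (\<Union>q0\<in>frontier \<Omega>. ball q0 (fst (p q0)))" by (intro UN_I[OF x]) simp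
    qed
  qed auto
  \<comment> \<open>Inserting 1 keeps the minimum meaningful even for an empty
    \<open>D\<close>.\<close>
  define r where "r = Min (insert 1 ((\<lambda>q0. snd (p q0)) ` D))"
  have r: "0 < r" using D p by (auto simp: r_def)
  show ?thesis
  proof (rule that[OF r])
    fix q assume q: "q \<in> frontier \<Omega>"
    then obtain q0 where q0: "q0 \<in> D" "q \<in> ball q0 (fst (p q0))" using D by auto
    have "r \<le> snd (p q0)" using q0 D by (auto simp: r_def)
    moreover obtain e where "norm e = 1" "ball (q + snd (p q0) *\<^sub>R e) (snd (p q0)) \<inter> \<Omega> = {}"
      "ball (q - snd (p q0) *\<^sub>R e) (snd (p q0)) \<subseteq> \<Omega>"
      using p q0 q D(1) by blast
    ultimately show "\<exists>e. norm e = 1 \<and> ball (q + r *\<^sub>R e) r \<inter> \<Omega> = {} \<and> ball (q - r *\<^sub>R e) r \<subseteq> \<Omega>"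
      using tangent_ball_mono[OF \<open>norm e = 1\<close> r, of "snd (p q0)" q] by (intro exI[of _ e]) blast
  qed
qed

section \<open>Comparison of the boundary distance with the tangent balls\<close>

text \<open>The segment from \<open>y\<close> to \<open>w\<close> crosses the frontier, at a point
  no farther from \<open>y\<close> than \<open>w\<close>.\<close>

lemma bdist_le_dist_exterior:
  fixes \<Omega> :: "'a::euclidean_space set"
  assumes y: "y \<in> \<Omega>" and w: "w \<notin> \<Omega>"
  shows "bdist \<Omega> y \<le> dist y w"
proof -
  have "closed_segment y w \<inter> frontier \<Omega> \<noteq> {}"
    by (rule connected_Int_frontier) (use y w in \<open>auto intro: connected_segment\<close>)
  then obtain f where f: "f \<in> closed_segment y w" "f \<in> frontier \<Omega>" by blast
  have "bdist \<Omega> y \<le> dist y f" unfolding bdist_def by (rule infdist_le[OF f(2)])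
  also have "\<dots> \<le> dist y w" using dist_in_closed_segment[OF f(1)] by (simp add: dist_commute)
  finally show ?thesis .
qed

text \<open>The point \<open>w\<close> on the segment from \<open>z\<close> to \<open>y\<close>, at
  depth \<open>d\<close> inside the ball, is outside \<open>\<Omega>\<close> and at distance
  \<open>norm (y - z) - r + d\<close> from \<open>y\<close>; here \<open>d\<close> is arbitrarily
  small.\<close>

lemma bdist_le_exterior_ball:
  fixes \<Omega> :: "'a::euclidean_space set"
  assumes y: "y \<in> \<Omega>" and ball: "ball z r \<inter> \<Omega> = {}" and "0 < r"
  shows "bdist \<Omega> y + r \<le> norm (y - z)"
proof (rule field_le_epsilon)
  fix e :: real assume e: "0 < e"
  define d where "d = min e r / 2"
  have d: "0 < d" "d < e" "d < r" using e \<open>0 < r\<close> by (auto simp: d_def min_def)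
  have yz: "norm (y - z) \<ge> r" using y ball by (force simp: dist_norm norm_minus_commute)
  hence n0: "norm (y - z) > 0" using \<open>0 < r\<close> by linarith
  define w where "w = z + ((r - d) / norm (y - z)) *\<^sub>R (y - z)"
  have "dist z w = r - d" using n0 d by (simp add: w_def dist_norm)
  hence "w \<in> ball z r" using d by simp
  hence "w \<notin> \<Omega>" using ball by blast
  have "y - w = (1 - (r - d) / norm (y - z)) *\<^sub>R (y - z)" by (simp add: w_def algebra_simps)
  hence "dist y w = \<bar>1 - (r - d) / norm (y - z)\<bar> * norm (y - z)" by (simp add: dist_norm)
  also have "\<dots> = norm (y - z) - (r - d)"
    using yz n0 d by (simp add: abs_of_nonneg field_simps)
  finally show "bdist \<Omega> y + r \<le> norm (y - z) + e"
    using bdist_le_dist_exterior[OF y \<open>w \<notin> \<Omega>\<close>] d by simp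
qed

text \<open>At the boundary point \<open>q\<close> nearest to \<open>x\<close>, the exterior and the
  interior ball give comparison functions that touch \<open>bdist \<Omega>\<close> at
  \<open>x\<close> from above and below. They bound the quadratic form by \<open>1 / (r + t)\<close>
  from above and \<open>- 1 / (r - t)\<close> from below, relative to the squared norm of
  \<open>v\<close>; \<open>t < r / 2\<close> turns both into \<open>2 / r\<close>.\<close>

lemma bdist_hessian_bound:
  fixes \<Omega> :: "'a::euclidean_space set"
  assumes \<Omega>: "open \<Omega>" "frontier \<Omega> \<noteq> {}" and "0 < r"
    and balls: "\<And>q. q \<in> frontier \<Omega> \<Longrightarrow> \<exists>e. norm e = 1 \<and>
      ball (q + r *\<^sub>R e) r \<inter> \<Omega> = {} \<and> ball (q - r *\<^sub>R e) r \<subseteq> \<Omega>"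
    and V: "open V" "V \<subseteq> strip \<Omega> (r / 2)" "x \<in> V"
    and \<Phi>: "\<And>y. y \<in> V \<Longrightarrow> (bdist \<Omega> has_derivative (\<lambda>h. \<nu> y \<bullet> h)) (at y)"
    and \<nu>: "(\<nu> has_derivative A) (at x)"
  shows "\<bar>A v \<bullet> v\<bar> \<le> 2 / r * (norm v)\<^sup>2"
proof -
  define t where "t = bdist \<Omega> x"
  have t: "0 \<le> t" "t < r / 2" using V by (auto simp: t_def bdist_def infdist_nonneg strip_def)
  have x: "x \<in> \<Omega>" using V by (auto simp: strip_def)
  obtain q where q: "q \<in> frontier \<Omega>" "t = dist x q"
    unfolding t_def bdist_def using infdist_attains_inf[OF frontier_closed \<Omega>(2)] by metis
  obtain e where e: "norm e = 1" "ball (q + r *\<^sub>R e) r \<inter> \<Omega> = {}" "ball (q - r *\<^sub>R e) r \<subseteq> \<Omega>"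
    using balls[OF q(1)] by blast
  define z where "z = q + r *\<^sub>R e"
  define z' where "z' = q - r *\<^sub>R e"
  have up: "bdist \<Omega> y + r \<le> norm (y - z)" if "y \<in> \<Omega>" for y
    unfolding z_def by (rule bdist_le_exterior_ball[OF that e(2) \<open>0 < r\<close>])
  have zq: "norm (q - z) = r" using e \<open>0 < r\<close> by (simp add: z_def)
  have "norm (x - z) \<le> norm (x - q) + norm (q - z)"
    using norm_triangle_ineq[of "x - q" "q - z"] by simp
  hence xz: "norm (x - z) = t + r" using up[OF x] zq q(2) by (simp add: t_def dist_norm)
  \<comment> \<open>Equality in the triangle inequality makes \<open>x - q\<close> a multiple of the
    normal \<open>e\<close>. This determines the distance from \<open>x\<close> to the interior
    centre \<open>z'\<close>.\<close>
  have "norm ((x - q) + (q - z)) = norm (x - q) + norm (q - z)"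
    using xz zq q(2) by (simp add: dist_norm)
  hence "norm (x - q) *\<^sub>R (q - z) = norm (q - z) *\<^sub>R (x - q)" by (simp only: norm_triangle_eq)
  hence "r *\<^sub>R (x - q) = r *\<^sub>R (- t *\<^sub>R e)"
    using zq q(2) by (simp add: dist_norm z_def mult.commute)
  hence "x - q = - t *\<^sub>R e" using \<open>0 < r\<close> by (metis less_irrefl scaleR_cancel_left)
  hence "x - z' = (r - t) *\<^sub>R e" by (simp add: z'_def algebra_simps)
  hence xz': "norm (x - z') = r - t" using e t \<open>0 < r\<close> by simp
  \<comment> \<open>The interior ball contains no boundary point. Together with the Lipschitz
    constant 1 of the distance this gives the comparison \<open>low\<close>.\<close>
  have "r \<le> bdist \<Omega> z'"
  proof -
    have "r \<le> dist z' w" if "w \<in> frontier \<Omega>" for w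
    proof -
      have "w \<notin> \<Omega>" using that \<Omega>(1) by (auto simp: frontier_def interior_open)
      hence "w \<notin> ball z' r" using e(3) unfolding z'_def by blast
      thus ?thesis by simp
    qed
    thus ?thesis unfolding bdist_def infdist_def using \<Omega>(2) by (auto intro!: cINF_greatest)
  qed
  hence low: "r - bdist \<Omega> y \<le> norm (y - z')" for y
    using infdist_triangle[of z' "frontier \<Omega>" y] by (simp add: bdist_def dist_norm norm_minus_commute)
  have "(t + r) * (A v \<bullet> v) \<le> (norm v)\<^sup>2"
    unfolding t_def
  proof (rule touching_hessian_bound[OF V(1,3) \<Phi> \<nu>])
    show "(bdist \<Omega> y + r)\<^sup>2 \<le> (norm (y - z))\<^sup>2" if "y \<in> V" for y
      using up[of y] that V \<open>0 < r\<close>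
      by (intro power_mono) (auto simp: strip_def bdist_def infdist_nonneg)
  qed (use xz in \<open>auto simp: t_def\<close>)
  moreover have "(t + (- r)) * (A v \<bullet> v) \<le> (norm v)\<^sup>2"
    unfolding t_def
  proof (rule touching_hessian_bound[OF V(1,3) \<Phi> \<nu>])
    show "(bdist \<Omega> y + (- r))\<^sup>2 \<le> (norm (y - z'))\<^sup>2" if "y \<in> V" for y
    proof -
      \<comment> \<open>On the strip of width \<open>r / 2\<close> the left base is nonnegative, so
        squaring preserves the inequality.\<close>
      have "(r - bdist \<Omega> y)\<^sup>2 \<le> (norm (y - z'))\<^sup>2"
        using low[of y] that V \<open>0 < r\<close> by (intro power_mono) (auto simp: strip_def)
      thus ?thesis by (simp add: power2_commute)
    qed
  qed (use xz' in \<open>auto simp: t_def power2_commute\<close>)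
  ultimately have a: "(r + t) * (A v \<bullet> v) \<le> (norm v)\<^sup>2" "(r - t) * (- (A v \<bullet> v)) \<le> (norm v)\<^sup>2"
    by (auto simp: algebra_simps)
  have "r / 2 * \<bar>A v \<bullet> v\<bar> \<le> (norm v)\<^sup>2"
  proof (cases "A v \<bullet> v \<ge> 0")
    case True
    have "r / 2 * (A v \<bullet> v) \<le> (r + t) * (A v \<bullet> v)" using t True by (intro mult_right_mono) auto
    thus ?thesis using a(1) True by simp
  next
    case False
    have "r / 2 * (- (A v \<bullet> v)) \<le> (r - t) * (- (A v \<bullet> v))" using t False by (intro mult_right_mono) auto
    thus ?thesis using a(2) False by linarith
  qed
  thus ?thesis using \<open>0 < r\<close> by (simp add: field_simps)
qed

section \<open>Rellich and energy identities\<close>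

lemma sum_Basis_linear:
  fixes L :: "'a::euclidean_space \<Rightarrow> real"
  assumes "linear L"
  shows "(\<Sum>b\<in>Basis. L b * (v \<bullet> b)) = L v"
proof -
  have "L v = L (\<Sum>b\<in>Basis. (v \<bullet> b) *\<^sub>R b)" by (simp add: euclidean_representation)
  also have "\<dots> = (\<Sum>b\<in>Basis. L b * (v \<bullet> b))"
    by (simp add: linear_sum[OF assms] linear_scale[OF assms] mult.commute)
  finally show ?thesis by simp
qed

text \<open>The integral identities depend only on these pointwise derivatives. In the application
  \<open>\<nu>\<close> and \<open>A\<close> are gradient and Hessian of the boundary distance,
  \<open>u\<close> is \<open>p - p0\<close>, and \<open>P\<close>, \<open>H\<close> are gradient and
  Hessian of \<open>p\<close>; \<open>trH\<close> expresses harmonicity.\<close>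

locale strip_calculus =
  fixes U :: "'a::euclidean_space set" and \<Phi> :: "'a \<Rightarrow> real" and \<nu> :: "'a \<Rightarrow> 'a"
    and A :: "'a \<Rightarrow> 'a \<Rightarrow> 'a" and u :: "'a \<Rightarrow> real" and P :: "'a \<Rightarrow> 'a" and H :: "'a \<Rightarrow> 'a \<Rightarrow> 'a"
  assumes openU: "open U"
    and \<Phi>: "\<And>x. x \<in> U \<Longrightarrow> (\<Phi> has_derivative (\<lambda>h. \<nu> x \<bullet> h)) (at x)"
    and \<nu>: "\<And>x. x \<in> U \<Longrightarrow> (\<nu> has_derivative A x) (at x)"
    and \<nu>1: "\<And>x. x \<in> U \<Longrightarrow> norm (\<nu> x) = 1"
    and contA: "\<And>v. continuous_on U (\<lambda>x. A x v)"
    and u: "\<And>x. x \<in> U \<Longrightarrow> (u has_derivative (\<lambda>h. P x \<bullet> h)) (at x)"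
    and P: "\<And>x. x \<in> U \<Longrightarrow> (P has_derivative H x) (at x)"
    and contH: "\<And>v. continuous_on U (\<lambda>x. H x v)"
    and symH: "\<And>x v w. x \<in> U \<Longrightarrow> H x v \<bullet> w = H x w \<bullet> v"
    and trH: "\<And>x. x \<in> U \<Longrightarrow> (\<Sum>b\<in>Basis. H x b \<bullet> b) = 0"
begin

lemma linA: "x \<in> U \<Longrightarrow> linear (A x)" and linH: "x \<in> U \<Longrightarrow> linear (H x)"
  using \<nu> P has_derivative_linear by blast+

lemma conts: "continuous_on U \<Phi>" "continuous_on U \<nu>" "continuous_on U u" "continuous_on U P"
  by (auto intro!: continuous_at_imp_continuous_on dest: \<Phi> \<nu> u P has_derivative_continuous)

definition trA where "trA x = (\<Sum>b\<in>Basis. A x b \<bullet> b)"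

lemma cont_trA: "continuous_on U trA"
  unfolding trA_def[abs_def] by (intro continuous_intros contA)

lemma AP_eq: "x \<in> U \<Longrightarrow> A x (P x) \<bullet> P x = (\<Sum>b\<in>Basis. (P x \<bullet> b) * (A x b \<bullet> P x))"
  using sum_Basis_linear[of "\<lambda>h. A x h \<bullet> P x" "P x"] linA[of x]
  by (simp add: mult.commute linear_compose[of "A x" "\<lambda>y. y \<bullet> P x", unfolded comp_def]
      bounded_linear.linear[OF bounded_linear_inner_left])

lemma cont_AP: "continuous_on U (\<lambda>x. A x (P x) \<bullet> P x)"
proof -
  have "continuous_on U (\<lambda>x. \<Sum>b\<in>Basis. (P x \<bullet> b) * (A x b \<bullet> P x))"
    by (intro continuous_intros contA conts)
  thus ?thesis by (rule continuous_on_eq) (simp add: AP_eq)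
qed

lemma comp_has_derivative:
  assumes "x \<in> U" "(g has_real_derivative g' (\<Phi> x)) (at (\<Phi> x))"
  shows "((\<lambda>x. g (\<Phi> x)) has_derivative (\<lambda>h. g' (\<Phi> x) * (\<nu> x \<bullet> h))) (at x)"
  using has_derivative_compose[OF \<Phi>[OF assms(1)], of g "(*) (g' (\<Phi> x))"] assms(2)
  by (simp add: has_field_derivative_def)

text \<open>The divergence theorem for the field \<open>g (\<Phi> x) *\<^sub>R V x\<close>, with
  \<open>V\<close> the Rellich field below. In the divergence of \<open>V\<close> the terms in
  \<open>H\<close> cancel by \<open>symH\<close> or vanish by \<open>trH\<close>, so only the
  curvature terms in \<open>A\<close> remain.\<close>

lemma rellich:
  assumes g: "\<And>t. (g has_real_derivative g' t) (at t)" "continuous_on UNIV g'"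
    and K: "compact K" "K \<subseteq> U" "\<And>x. x \<in> U - K \<Longrightarrow> g (\<Phi> x) = 0"
  shows "(LINT x:U|lborel. g' (\<Phi> x) * ((norm (P x))\<^sup>2 - 2 * (\<nu> x \<bullet> P x)\<^sup>2)
      + g (\<Phi> x) * ((norm (P x))\<^sup>2 * trA x - 2 * (A x (P x) \<bullet> P x))) = 0"
proof -
  define V where "V x = (P x \<bullet> P x) *\<^sub>R \<nu> x - (2 * (\<nu> x \<bullet> P x)) *\<^sub>R P x" for x
  define V' where "V' x h = (2 * (P x \<bullet> H x h)) *\<^sub>R \<nu> x + (P x \<bullet> P x) *\<^sub>R A x h
     - ((2 * (A x h \<bullet> P x + \<nu> x \<bullet> H x h)) *\<^sub>R P x + (2 * (\<nu> x \<bullet> P x)) *\<^sub>R H x h)" for x h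
  define F' where "F' x h = (g' (\<Phi> x) * (\<nu> x \<bullet> h)) *\<^sub>R V x + g (\<Phi> x) *\<^sub>R V' x h" for x h
  have V: "(V has_derivative V' x) (at x)" if x: "x \<in> U" for x
    unfolding V_def[abs_def] V'_def[abs_def]
    by (rule derivative_eq_intros P[OF x] \<nu>[OF x] refl)+
       (auto simp: fun_eq_iff algebra_simps inner_commute)
  have "continuous_on U g" for U
    using g(1) by (auto intro!: continuous_at_imp_continuous_on DERIV_isCont)
  note contg = continuous_on_compose2[OF this conts(1) subset_UNIV]
  have contg': "continuous_on U (\<lambda>x. g' (\<Phi> x))"
    using continuous_on_compose2[OF g(2) conts(1)] by auto
  have "(LINT x:U|lborel. (\<Sum>b\<in>Basis. F' x b \<bullet> b)) = 0"
  proof (rule divergence_integral_eq_0[OF openU K(1,2)])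
    show "((\<lambda>x. g (\<Phi> x) *\<^sub>R V x) has_derivative F' x) (at x)" if x: "x \<in> U" for x
      unfolding F'_def[abs_def]
      using has_derivative_scaleR[OF comp_has_derivative[where g=g and g'=g', OF x g(1)] V[OF x]]
      by (simp add: add.commute)
    show "continuous_on U (\<lambda>x. F' x b)" for b
      unfolding F'_def V_def V'_def
      by (intro continuous_intros conts contA contH contg contg')
    show "g (\<Phi> x) *\<^sub>R V x = 0" if "x \<in> U - K" for x using K(3)[OF that] by simp
  qed
  moreover have "(\<Sum>b\<in>Basis. F' x b \<bullet> b) = g' (\<Phi> x) * ((norm (P x))\<^sup>2 - 2 * (\<nu> x \<bullet> P x)\<^sup>2)
      + g (\<Phi> x) * ((norm (P x))\<^sup>2 * trA x - 2 * (A x (P x) \<bullet> P x))" if x: "x \<in> U" for x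
  proof -
    have e1: "(\<Sum>b\<in>Basis. (\<nu> x \<bullet> b) * (V x \<bullet> b)) = (norm (P x))\<^sup>2 - 2 * (\<nu> x \<bullet> P x)\<^sup>2"
    proof -
      have "\<nu> x \<bullet> \<nu> x = 1" using \<nu>1[OF x] by (simp add: norm_eq_1)
      moreover have "(\<Sum>b\<in>Basis. (\<nu> x \<bullet> b) * (V x \<bullet> b)) = \<nu> x \<bullet> V x"
        by (rule euclidean_inner[symmetric])
      ultimately show ?thesis
        by (simp add: V_def inner_diff_right power2_eq_square dot_square_norm)
    qed
    have e2: "(\<Sum>b\<in>Basis. (P x \<bullet> H x b) * (\<nu> x \<bullet> b)) = P x \<bullet> H x (\<nu> x)"
      by (rule sum_Basis_linear, rule linear_compose[of "H x" "\<lambda>y. P x \<bullet> y", unfolded comp_def])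
         (auto intro: linH x bounded_linear.linear[OF bounded_linear_inner_right])
    have e3: "(\<Sum>b\<in>Basis. (\<nu> x \<bullet> H x b) * (P x \<bullet> b)) = \<nu> x \<bullet> H x (P x)"
      by (rule sum_Basis_linear, rule linear_compose[of "H x" "\<lambda>y. \<nu> x \<bullet> y", unfolded comp_def])
         (auto intro: linH x bounded_linear.linear[OF bounded_linear_inner_right])
    have e4: "(\<Sum>b\<in>Basis. (A x b \<bullet> P x) * (P x \<bullet> b)) = A x (P x) \<bullet> P x"
      using AP_eq[OF x] by (simp add: mult.commute)
    have e5: "P x \<bullet> H x (\<nu> x) = \<nu> x \<bullet> H x (P x)"
      using symH[OF x, of "\<nu> x" "P x"] by (simp add: inner_commute)
    have "(\<Sum>b\<in>Basis. V' x b \<bullet> b) = 2 * (\<Sum>b\<in>Basis. (P x \<bullet> H x b) * (\<nu> x \<bullet> b)) + (P x \<bullet> P x) * trA x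
        - (2 * (\<Sum>b\<in>Basis. (A x b \<bullet> P x) * (P x \<bullet> b)) + 2 * (\<Sum>b\<in>Basis. (\<nu> x \<bullet> H x b) * (P x \<bullet> b))
        + 2 * (\<nu> x \<bullet> P x) * (\<Sum>b\<in>Basis. H x b \<bullet> b))"
      unfolding V'_def trA_def
      by (simp add: inner_add_left inner_diff_left sum.distrib sum_subtractf sum_distrib_left algebra_simps)
    also have "\<dots> = (norm (P x))\<^sup>2 * trA x - 2 * (A x (P x) \<bullet> P x)"
      unfolding e2 e3 e4 e5 trH[OF x] by (simp add: power2_norm_eq_inner)
    finally have V': "(\<Sum>b\<in>Basis. V' x b \<bullet> b) = (norm (P x))\<^sup>2 * trA x - 2 * (A x (P x) \<bullet> P x)" .
    have "(\<Sum>b\<in>Basis. F' x b \<bullet> b) = g' (\<Phi> x) * (\<Sum>b\<in>Basis. (\<nu> x \<bullet> b) * (V x \<bullet> b)) + g (\<Phi> x) * (\<Sum>b\<in>Basis. V' x b \<bullet> b)"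
      unfolding F'_def by (simp add: inner_add_left sum.distrib sum_distrib_left mult.assoc)
    thus ?thesis unfolding e1 V' .
  qed
  ultimately show ?thesis
    using set_lebesgue_integral_cong[of U lborel] openU by (metis (no_types, lifting) borel_open sets_lborel)
qed

text \<open>The divergence theorem for \<open>w (\<Phi> x) *\<^sub>R (u x *\<^sub>R P x)\<close>:
  harmonicity removes the second derivatives, and the weighted gradient energy is expressed through
  \<open>u\<close> itself, as in Caccioppoli's inequality.\<close>

lemma energy:
  assumes w: "\<And>t. (w has_real_derivative w' t) (at t)" "continuous_on UNIV w'"
    and K: "compact K" "K \<subseteq> U" "\<And>x. x \<in> U - K \<Longrightarrow> w (\<Phi> x) = 0"
  shows "(LINT x:U|lborel. w (\<Phi> x) * (norm (P x))\<^sup>2 + w' (\<Phi> x) * u x * (\<nu> x \<bullet> P x)) = 0"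
proof -
  define F' where "F' x h = (w' (\<Phi> x) * (\<nu> x \<bullet> h)) *\<^sub>R (u x *\<^sub>R P x)
     + w (\<Phi> x) *\<^sub>R ((P x \<bullet> h) *\<^sub>R P x + u x *\<^sub>R H x h)" for x h
  have "continuous_on U w" for U
    using w(1) by (auto intro!: continuous_at_imp_continuous_on DERIV_isCont)
  note contw = continuous_on_compose2[OF this conts(1) subset_UNIV]
  have contw': "continuous_on U (\<lambda>x. w' (\<Phi> x))"
    using continuous_on_compose2[OF w(2) conts(1)] by auto
  have "(LINT x:U|lborel. (\<Sum>b\<in>Basis. F' x b \<bullet> b)) = 0"
  proof (rule divergence_integral_eq_0[OF openU K(1,2)])
    show "((\<lambda>x. w (\<Phi> x) *\<^sub>R (u x *\<^sub>R P x)) has_derivative F' x) (at x)" if x: "x \<in> U" for x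
      unfolding F'_def[abs_def]
      using has_derivative_scaleR[OF comp_has_derivative[where g=w and g'=w', OF x w(1)] has_derivative_scaleR[OF u[OF x] P[OF x]]]
      by (simp add: add.commute)
    show "continuous_on U (\<lambda>x. F' x b)" for b
      unfolding F'_def
      by (intro continuous_intros conts contA contH contw contw')
    show "w (\<Phi> x) *\<^sub>R (u x *\<^sub>R P x) = 0" if "x \<in> U - K" for x using K(3)[OF that] by simp
  qed
  moreover have "(\<Sum>b\<in>Basis. F' x b \<bullet> b) = w (\<Phi> x) * (norm (P x))\<^sup>2 + w' (\<Phi> x) * u x * (\<nu> x \<bullet> P x)"
    if x: "x \<in> U" for x
  proof -
    have "(\<Sum>b\<in>Basis. F' x b \<bullet> b) = w' (\<Phi> x) * u x * (\<Sum>b\<in>Basis. (\<nu> x \<bullet> b) * (P x \<bullet> b))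
       + w (\<Phi> x) * ((\<Sum>b\<in>Basis. (P x \<bullet> b) * (P x \<bullet> b)) + u x * (\<Sum>b\<in>Basis. H x b \<bullet> b))"
      unfolding F'_def
      by (simp add: inner_add_left sum.distrib sum_distrib_left algebra_simps)
    thus ?thesis
      unfolding euclidean_inner[symmetric] trH[OF x] by (simp add: power2_norm_eq_inner)
  qed
  ultimately show ?thesis
    using set_lebesgue_integral_cong[of U lborel] openU by (metis (no_types, lifting) borel_open sets_lborel)
qed

end

section \<open>Cutoff profiles\<close>

text \<open>Away from 1 and -1 the truncation is locally \<open>q\<close> or locally zero. At these
  two points its difference quotient is dominated by that of \<open>q\<close>, which tends to
  0.\<close>

lemma DERIV_extend_zero:
  fixes q :: "real \<Rightarrow> real"
  assumes q: "\<And>t. (q has_real_derivative q' t) (at t)"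
    and 0: "q 1 = 0" "q (-1) = 0" "q' 1 = 0" "q' (-1) = 0"
  shows "((\<lambda>t. if \<bar>t\<bar> \<le> 1 then q t else 0) has_real_derivative (if \<bar>t\<bar> \<le> 1 then q' t else 0)) (at t)"
proof -
  consider "\<bar>t\<bar> < 1" | "\<bar>t\<bar> > 1" | "t = 1 \<or> t = -1" by linarith
  thus ?thesis
  proof cases
    case 1
    have "((\<lambda>t. if \<bar>t\<bar> \<le> 1 then q t else 0) has_real_derivative q' t) (at t)"
      by (rule has_field_derivative_transform_within_open[OF q, of "{-1<..<1}"]) (use 1 in auto)
    thus ?thesis using 1 by simp
  next
    case 2
    have "open {t::real. 1 < \<bar>t\<bar>}" by (intro open_Collect_less continuous_intros)
    hence "((\<lambda>t. if \<bar>t\<bar> \<le> 1 then q t else 0) has_real_derivative 0) (at t)"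
      by (rule has_field_derivative_transform_within_open[OF DERIV_const[of 0]]) (use 2 in auto)
    thus ?thesis using 2 by simp
  next
    case 3
    hence qt: "q t = 0" "q' t = 0" using 0 by auto
    have lim: "((\<lambda>h. (q (t + h) - q t) / h) \<longlongrightarrow> 0) (at 0)"
      using q[of t] qt by (simp add: DERIV_def)
    have "((\<lambda>h. ((if \<bar>t + h\<bar> \<le> 1 then q (t + h) else 0) - 0) / h) \<longlongrightarrow> 0) (at 0)"
      by (rule Lim_null_comparison[OF _ tendsto_norm_zero[OF lim]]) (auto simp: qt)
    thus ?thesis using 3 qt 0 by (auto simp: DERIV_def)
  qed
qed

text \<open>Since \<open>q\<close> vanishes at both endpoints, truncating it is the same as
  composing it with the clamping of \<open>t\<close> to \<open>[-1, 1]\<close>.\<close>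

lemma continuous_on_extend_zero_real:
  fixes q :: "real \<Rightarrow> real"
  assumes "continuous_on UNIV q" "q 1 = 0" "q (-1) = 0"
  shows "continuous_on S (\<lambda>t. if \<bar>t\<bar> \<le> 1 then q t else 0)"
proof -
  have "continuous_on S (\<lambda>t. q (max (-1) (min 1 t)))"
    by (rule continuous_on_compose2[OF assms(1)]) (auto intro!: continuous_intros)
  moreover have "q (max (-1) (min 1 t)) = (if \<bar>t\<bar> \<le> 1 then q t else 0)" for t
    using assms(2,3) by (auto simp: max_def min_def abs_le_iff)
  ultimately show ?thesis by simp
qed

section \<open>The cutoff, the bump and the primitive of their difference\<close>

text \<open>For \<open>k \<ge> 1\<close> a continuous cutoff supported in \<open>[-1, 1]\<close>,
  which tends to 1 at every interior point as \<open>k\<close> grows.\<close>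

definition plateau :: "nat \<Rightarrow> real \<Rightarrow> real" where
  "plateau k t = (if \<bar>t\<bar> \<le> 1 then 1 - t ^ (2 * k) else 0)"

text \<open>The square of a parabola: its derivative keeps one factor of the parabola, which Young's
  inequality absorbs into the bump.\<close>

definition bump :: "real \<Rightarrow> real" where
  "bump t = (if \<bar>t\<bar> \<le> 1 then (1 - t\<^sup>2)\<^sup>2 else 0)"

definition bump' :: "real \<Rightarrow> real" where
  "bump' t = (if \<bar>t\<bar> \<le> 1 then - 4 * t * (1 - t\<^sup>2) else 0)"

text \<open>The constant makes the integral of \<open>plateau k - plateau_const k * bump\<close> over \<open>[-1, 1]\<close> vanish,
  so that its primitive has compact support.\<close>

definition plateau_const :: "nat \<Rightarrow> real" where
  "plateau_const k = 15 * k / (4 * (2 * k + 1))"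

definition primitive :: "nat \<Rightarrow> real \<Rightarrow> real" where
  "primitive k t = (if \<bar>t\<bar> \<le> 1 then t - t ^ (2 * k + 1) / (2 * k + 1)
      - plateau_const k * (t - 2 * t ^ 3 / 3 + t ^ 5 / 5) else 0)"

lemma plateau_const_bounds: "0 \<le> plateau_const k" "plateau_const k \<le> 15 / 8"
  by (auto simp: plateau_const_def field_simps)

lemma pow_even_le_1: "\<bar>t\<bar> \<le> 1 \<Longrightarrow> (t::real) ^ (2 * k) \<le> 1"
  by (simp add: power_mult abs_square_le_1 power_le_one)

lemma plateau_bounds: "0 \<le> plateau k t" "plateau k t \<le> 1"
  using pow_even_le_1[of t k] by (auto simp: plateau_def power_mult)

lemma bump_nonneg: "0 \<le> bump t"
  by (simp add: bump_def)

lemma bump_le_plateau: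
  assumes "1 \<le> k" shows "bump t \<le> plateau k t"
proof (cases "\<bar>t\<bar> \<le> 1")
  case True
  hence t: "t\<^sup>2 \<le> 1" by (simp add: abs_square_le_1)
  have "t ^ (2 * k) \<le> t\<^sup>2"
    unfolding power_mult using power_decreasing[of 1 k "t\<^sup>2"] assms t by simp
  moreover have "(1 - t\<^sup>2)\<^sup>2 \<le> 1 - t\<^sup>2"
    unfolding power2_eq_square[of "1 - t\<^sup>2"] using t mult_left_le[of "1 - t\<^sup>2" "1 - t\<^sup>2"] by simp
  ultimately show ?thesis using True by (simp add: bump_def plateau_def)
qed (simp add: bump_def plateau_def)

lemma continuous_plateau: "1 \<le> k \<Longrightarrow> continuous_on S (plateau k)"
  unfolding plateau_def[abs_def]
  by (rule continuous_on_extend_zero_real) (auto intro!: continuous_intros)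

lemma continuous_bump: "continuous_on S bump" "continuous_on S bump'"
  unfolding bump_def[abs_def] bump'_def[abs_def]
  by (rule continuous_on_extend_zero_real; auto intro!: continuous_intros)+

lemma bump_deriv: "(bump has_real_derivative bump' t) (at t)"
  unfolding bump_def[abs_def] bump'_def
  by (rule DERIV_extend_zero) (auto intro!: derivative_eq_intros simp: power2_eq_square algebra_simps)

lemma primitive_deriv:
  assumes "1 \<le> k"
  shows "(primitive k has_real_derivative plateau k t - plateau_const k * bump t) (at t)"
proof -
  have "(primitive k has_real_derivative
      (if \<bar>t\<bar> \<le> 1 then 1 - t ^ (2 * k) - plateau_const k * (1 - t\<^sup>2)\<^sup>2 else 0)) (at t)"
    unfolding primitive_def[abs_def]
  proof (rule DERIV_extend_zero)
    have pow: "((\<lambda>t. t ^ (2 * k + 1) / (2 * k + 1)) has_real_derivative t ^ (2 * k)) (at t)" for t :: real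
      using DERIV_cdivide[OF DERIV_pow[of "2 * k + 1" t], of "2 * k + 1"] by (simp add: add_ac)
    have poly: "((\<lambda>t. t - 2 * t ^ 3 / 3 + t ^ 5 / 5) has_real_derivative (1 - t\<^sup>2)\<^sup>2) (at t)" for t :: real
      by (auto intro!: derivative_eq_intros simp: eval_nat_numeral algebra_simps)
    show "((\<lambda>t. t - t ^ (2 * k + 1) / (2 * k + 1) - plateau_const k * (t - 2 * t ^ 3 / 3 + t ^ 5 / 5))
        has_real_derivative 1 - t ^ (2 * k) - plateau_const k * (1 - t\<^sup>2)\<^sup>2) (at t)" for t :: real
      by (rule DERIV_diff[OF DERIV_diff[OF DERIV_ident pow] DERIV_cmult[OF poly]])
  qed (use assms in \<open>auto simp: plateau_const_def field_simps\<close>)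
  thus ?thesis by (auto simp: plateau_def bump_def)
qed

lemma primitive_minus: "primitive k (- t) = - primitive k t"
  by (simp add: primitive_def algebra_simps)

text \<open>As \<open>0 \<le> plateau_const k * bump t \<le> 2 * plateau k t\<close>, the slope of
  the primitive is at most the plateau in absolute value. The primitive vanishes at 1, so the mean
  value theorem on \<open>[t, 1]\<close> and the monotonicity of the plateau on
  \<open>[0, 1]\<close> give the bound for \<open>t \<ge> 0\<close>; oddness gives the rest.\<close>

lemma primitive_bound:
  assumes k: "1 \<le> k"
  shows "\<bar>primitive k t\<bar> \<le> plateau k t"
proof -
  have slope: "\<bar>plateau k t - plateau_const k * bump t\<bar> \<le> plateau k t" for t
  proof -
    have "plateau_const k * bump t \<le> 2 * plateau k t"
      using plateau_const_bounds[of k] bump_nonneg[of t] bump_le_plateau[OF k, of t]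
      by (intro mult_mono) auto
    moreover have "0 \<le> plateau_const k * bump t"
      using plateau_const_bounds[of k] bump_nonneg[of t] by simp
    ultimately show ?thesis using plateau_bounds[of k t] by (simp add: abs_le_iff)
  qed
  have pos: "\<bar>primitive k t\<bar> \<le> plateau k t" if t: "0 \<le> t" "t < 1" for t
  proof -
    have "\<exists>z>t. z < 1 \<and> primitive k 1 - primitive k t = (1 - t) * (plateau k z - plateau_const k * bump z)"
      by (rule MVT2) (use t primitive_deriv[OF k] in auto)
    then obtain z where z: "t < z" "z < 1"
      "primitive k 1 - primitive k t = (1 - t) * (plateau k z - plateau_const k * bump z)" by blast
    have "primitive k 1 = 0" using k by (auto simp: primitive_def plateau_const_def field_simps)
    hence "\<bar>primitive k t\<bar> = \<bar>(1 - t) * (plateau k z - plateau_const k * bump z)\<bar>" using z by linarith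
    also have "\<dots> = (1 - t) * \<bar>plateau k z - plateau_const k * bump z\<bar>" using t by (simp add: abs_mult)
    also have "\<dots> \<le> 1 * plateau k z" using slope[of z] t by (intro mult_mono) auto
    also have "\<dots> \<le> plateau k t" using z t by (auto simp: plateau_def power_mono)
    finally show ?thesis .
  qed
  show ?thesis
  proof (cases "\<bar>t\<bar> < 1")
    case True
    have "plateau k (- t) = plateau k t" by (simp add: plateau_def)
    thus ?thesis using pos[of t] pos[of "- t"] True primitive_minus[of k t] by (cases "0 \<le> t") auto
  next
    case False
    have "primitive k t = 0"
    proof (cases "\<bar>t\<bar> = 1")
      case True
      hence "t = 1 \<or> t = -1" by linarith
      thus ?thesis using k by (auto simp: primitive_def plateau_const_def field_simps)
    next
      case F: False
      thus ?thesis using False by (simp add: primitive_def)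
    qed
    thus ?thesis using plateau_bounds by simp
  qed
qed

section \<open>The weighted estimate\<close>

context strip_calculus
begin

definition T where "T x = (norm (P x - (\<nu> x \<bullet> P x) *\<^sub>R \<nu> x))\<^sup>2"

lemma T_eq: "x \<in> U \<Longrightarrow> T x = (norm (P x))\<^sup>2 - (\<nu> x \<bullet> P x)\<^sup>2"
proof -
  assume "x \<in> U"
  hence "\<nu> x \<bullet> \<nu> x = 1" using \<nu>1 by (simp add: norm_eq_1)
  thus ?thesis
    unfolding T_def power2_norm_eq_inner power2_eq_square[of "\<nu> x \<bullet> P x"]
    by (simp add: inner_diff_left inner_diff_right inner_commute)
qed

lemma cont_T: "continuous_on U T"
  unfolding T_def[abs_def] by (intro continuous_intros conts)

text \<open>The inequality is shown pointwise up to the summands \<open>R x\<close> and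
  \<open>c * E x\<close>, whose integrals vanish by \<open>rellich\<close> and
  \<open>energy\<close>. Rellich's identity exchanges the plateau for a multiple of the bump, at the
  cost of a curvature error of relative size \<open>(b - a) * C / 2\<close>; the energy identity
  then handles the bump.\<close>

lemma weighted_estimate:
  fixes a b C :: real and k :: nat
  defines "\<tau> \<equiv> (\<lambda>t. (2 * t - a - b) / (b - a))" and "K \<equiv> {x \<in> U. a \<le> \<Phi> x \<and> \<Phi> x \<le> b}"
  assumes ab: "a < b" and k: "1 \<le> k" and K: "compact K"
    and C: "\<And>x. x \<in> U \<Longrightarrow> \<bar>(norm (P x))\<^sup>2 * trA x - 2 * (A x (P x) \<bullet> P x)\<bar> \<le> C * (norm (P x))\<^sup>2"
  shows "(1 - (b - a) * C / 2) * (LINT x:U|lborel. plateau k (\<tau> (\<Phi> x)) * T x)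
    \<le> (1 + (b - a) * C / 2) * (LINT x:U|lborel. plateau k (\<tau> (\<Phi> x)) * (\<nu> x \<bullet> P x)\<^sup>2)
      + 15 / (b - a)\<^sup>2 * (LINT x:K|lborel. (u x)\<^sup>2)"
    and "set_integrable lborel U (\<lambda>x. plateau k (\<tau> (\<Phi> x)) * T x)"
    and "set_integrable lborel U (\<lambda>x. plateau k (\<tau> (\<Phi> x)) * (\<nu> x \<bullet> P x)\<^sup>2)"
    and "set_integrable lborel K (\<lambda>x. (u x)\<^sup>2)"
proof -
  define l where "l = b - a"
  have l: "l > 0" using ab by (simp add: l_def)
  define c where "c = plateau_const k"
  \<comment> \<open>The factor \<open>l / 2\<close> compensates the derivative \<open>2 / l\<close>
    of the affine map \<open>\<tau>\<close> from \<open>[a, b]\<close> onto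
    \<open>[-1, 1]\<close>.\<close>
  define g where "g t = l / 2 * primitive k (\<tau> t)" for t
  define g' where "g' t = plateau k (\<tau> t) - c * bump (\<tau> t)" for t
  define w where "w t = bump (\<tau> t)" for t
  define w' where "w' t = bump' (\<tau> t) * (2 / l)" for t
  define \<eta> where "\<eta> x = plateau k (\<tau> (\<Phi> x))" for x
  have \<tau>: "(\<tau> has_real_derivative 2 / l) (at t)" for t
    unfolding \<tau>_def l_def[symmetric] using l by (auto intro!: derivative_eq_intros)
  have \<tau>cont: "continuous_on S \<tau>" for S
    using \<tau> by (auto intro!: continuous_at_imp_continuous_on DERIV_isCont)
  have g: "(g has_real_derivative g' t) (at t)" for t
    unfolding g_def[abs_def]
    by (rule DERIV_cong[OF DERIV_cmult[OF DERIV_chain2[OF primitive_deriv[OF k] \<tau>]]])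
       (use l in \<open>simp add: g'_def c_def\<close>)
  have w: "(w has_real_derivative w' t) (at t)" for t
    unfolding w_def[abs_def] w'_def by (rule DERIV_chain2[OF bump_deriv \<tau>])
  have cont\<tau>: "continuous_on S (\<lambda>t. plateau k (\<tau> t))" "continuous_on S (\<lambda>t. bump (\<tau> t))"
     "continuous_on S (\<lambda>t. bump' (\<tau> t))" for S
    using continuous_on_compose2[OF continuous_plateau[OF k] \<tau>cont subset_UNIV]
      continuous_on_compose2[OF continuous_bump(1) \<tau>cont subset_UNIV]
      continuous_on_compose2[OF continuous_bump(2) \<tau>cont subset_UNIV] by blast+
  have g'cont: "continuous_on S g'" and wcont: "continuous_on S w" and w'cont: "continuous_on S w'" for S
    unfolding g'_def w_def w'_def by (intro continuous_intros cont\<tau>)+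
  have gcont: "continuous_on S g" for S
    using g by (auto intro!: continuous_at_imp_continuous_on DERIV_isCont)
  have KU: "K \<subseteq> U" by (auto simp: K_def)
  have off: "\<not> \<bar>\<tau> (\<Phi> x)\<bar> \<le> 1" if "x \<in> U - K" for x
  proof
    assume "\<bar>\<tau> (\<Phi> x)\<bar> \<le> 1"
    hence "-1 \<le> \<tau> (\<Phi> x)" "\<tau> (\<Phi> x) \<le> 1" by linarith+
    hence "-1 \<le> (2 * \<Phi> x - a - b) / (b - a)" "(2 * \<Phi> x - a - b) / (b - a) \<le> 1"
      by (simp_all only: \<tau>_def)
    hence "a \<le> \<Phi> x" "\<Phi> x \<le> b" using ab by (auto simp: field_simps)
    thus False using that by (simp add: K_def)
  qed
  have zero: "\<eta> x = 0" "g (\<Phi> x) = 0" "g' (\<Phi> x) = 0" "w (\<Phi> x) = 0" "w' (\<Phi> x) = 0" if "x \<in> U - K" for x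
    using off[OF that] by (auto simp: \<eta>_def g_def g'_def w_def w'_def plateau_def primitive_def bump_def bump'_def)
  have cont\<eta>: "continuous_on U \<eta>"
    unfolding \<eta>_def by (rule continuous_on_compose2[OF cont\<tau>(1) conts(1) subset_UNIV])
  note cont\<Phi> = continuous_on_compose2[OF _ conts(1) subset_UNIV]
  define R where "R x = g' (\<Phi> x) * ((norm (P x))\<^sup>2 - 2 * (\<nu> x \<bullet> P x)\<^sup>2)
      + g (\<Phi> x) * ((norm (P x))\<^sup>2 * trA x - 2 * (A x (P x) \<bullet> P x))" for x
  define E where "E x = w (\<Phi> x) * (norm (P x))\<^sup>2 + w' (\<Phi> x) * u x * (\<nu> x \<bullet> P x)" for x
  have R0: "(LINT x:U|lborel. R x) = 0"
    unfolding R_def using zero by (intro rellich[OF g g'cont K KU]) auto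
  have E0: "(LINT x:U|lborel. E x) = 0"
    unfolding E_def using zero by (intro energy[OF w w'cont K KU]) auto
  have iR: "set_integrable lborel U R"
    by (rule set_integrable_compact_support[OF K KU])
       (auto simp: R_def[abs_def] zero intro!: continuous_intros conts cont_trA cont_AP cont\<Phi>[OF gcont] cont\<Phi>[OF g'cont])
  have iE: "set_integrable lborel U E"
    by (rule set_integrable_compact_support[OF K KU])
       (auto simp: E_def[abs_def] zero intro!: continuous_intros conts cont\<Phi>[OF wcont] cont\<Phi>[OF w'cont])
  have iT: "set_integrable lborel U (\<lambda>x. \<eta> x * T x)"
    by (rule set_integrable_compact_support[OF K KU]) (auto simp: zero intro!: continuous_intros cont\<eta> cont_T)
  have iN: "set_integrable lborel U (\<lambda>x. \<eta> x * (\<nu> x \<bullet> P x)\<^sup>2)"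
    by (rule set_integrable_compact_support[OF K KU]) (auto simp: zero intro!: continuous_intros cont\<eta> conts)
  have iu: "set_integrable lborel K (\<lambda>x. (u x)\<^sup>2)"
    unfolding set_integrable_def
    by (intro borel_integrable_compact K continuous_intros continuous_on_subset[OF conts(3) KU])
  have iuU: "set_integrable lborel U (\<lambda>x. indicator K x * (u x)\<^sup>2)"
    "(LINT x:U|lborel. indicator K x * (u x)\<^sup>2) = (LINT x:K|lborel. (u x)\<^sup>2)"
  proof -
    have "(\<lambda>x. indicator U x *\<^sub>R (indicator K x * (u x)\<^sup>2)) = (\<lambda>x. indicator K x *\<^sub>R (u x)\<^sup>2)"
      using KU by (auto simp: indicator_def fun_eq_iff)
    thus "set_integrable lborel U (\<lambda>x. indicator K x * (u x)\<^sup>2)"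
      "(LINT x:U|lborel. indicator K x * (u x)\<^sup>2) = (LINT x:K|lborel. (u x)\<^sup>2)"
      using iu by (simp_all add: set_integrable_def set_lebesgue_integral_def)
  qed
  have pw: "(1 - l * C / 2) * (\<eta> x * T x) \<le> (1 + l * C / 2) * (\<eta> x * (\<nu> x \<bullet> P x)\<^sup>2)
     + 15 / l\<^sup>2 * (indicator K x * (u x)\<^sup>2) + R x + c * E x" if x: "x \<in> U" for x
  proof (cases "x \<in> K")
    case False
    thus ?thesis using zero[of x] x by (simp add: R_def E_def)
  next
    case True
    define s where "s = \<tau> (\<Phi> x)"
    define n where "n = \<nu> x \<bullet> P x"
    define p where "p = (norm (P x))\<^sup>2"
    define D where "D = p * trA x - 2 * (A x (P x) \<bullet> P x)"
    have cb: "0 \<le> c" "c \<le> 15 / 8" using plateau_const_bounds by (auto simp: c_def)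
    \<comment> \<open>Young's inequality: the mixed term of \<open>E x\<close> is bounded by
      \<open>2 * f\<^sup>2 * n\<^sup>2\<close> plus a multiple of the square of \<open>u x\<close>,
      where \<open>s\<^sup>2 \<le> 1\<close> makes that multiple
      \<open>8 / l\<^sup>2\<close>.\<close>
    have absorb: "w (\<Phi> x) * (p - 2 * n\<^sup>2) \<le> E x + 8 / l\<^sup>2 * (u x)\<^sup>2"
    proof (cases "\<bar>s\<bar> \<le> 1")
      case in1: True
      define f where "f = 1 - s\<^sup>2"
      have ws: "w (\<Phi> x) = f\<^sup>2" "w' (\<Phi> x) = - 8 * s * f / l"
        using in1 by (auto simp: w_def w'_def s_def[symmetric] bump_def bump'_def f_def)
      have sq: "s\<^sup>2 \<le> 1" using in1 by (simp add: abs_square_le_1)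
      have "0 \<le> 2 * (f * n - 2 * s * (u x / l))\<^sup>2 + 8 * (1 - s\<^sup>2) * (u x / l)\<^sup>2"
        using sq by simp
      also have "\<dots> = 2 * f\<^sup>2 * n\<^sup>2 + (- 8 * s * f / l) * u x * n + 8 / l\<^sup>2 * (u x)\<^sup>2"
        by (simp add: power2_eq_square algebra_simps)
      finally show ?thesis unfolding E_def ws n_def[symmetric] p_def[symmetric]
        by (simp add: algebra_simps)
    next
      case False
      hence "w (\<Phi> x) = 0" "w' (\<Phi> x) = 0" by (auto simp: w_def w'_def s_def bump_def bump'_def)
      thus ?thesis by (simp add: E_def)
    qed
    have "c * (w (\<Phi> x) * (p - 2 * n\<^sup>2)) \<le> c * (E x + 8 / l\<^sup>2 * (u x)\<^sup>2)"
      by (rule mult_left_mono[OF absorb cb(1)])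
    \<comment> \<open>The constant 15 is 8 from Young's inequality times the bound
      \<open>15 / 8\<close> for \<open>c\<close>.\<close>
    also have "\<dots> \<le> c * E x + 15 / l\<^sup>2 * (u x)\<^sup>2"
      using mult_right_mono[OF cb(2), of "8 / l\<^sup>2 * (u x)\<^sup>2"] by (simp add: algebra_simps)
    finally have 1: "c * (w (\<Phi> x) * (p - 2 * n\<^sup>2)) \<le> c * E x + 15 / l\<^sup>2 * (u x)\<^sup>2" .
    have gb: "\<bar>g (\<Phi> x)\<bar> \<le> l / 2 * \<eta> x"
      using primitive_bound[OF k, of s] l by (simp add: g_def \<eta>_def s_def abs_mult)
    have "- (g (\<Phi> x) * D) \<le> \<bar>g (\<Phi> x)\<bar> * \<bar>D\<bar>" by (metis abs_ge_minus_self abs_mult)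
    also have "\<dots> \<le> (l / 2 * \<eta> x) * (C * p)"
      using gb C[OF x] plateau_bounds[of k s] l
      by (intro mult_mono) (auto simp: D_def p_def \<eta>_def s_def)
    finally have 2: "- (g (\<Phi> x) * D) \<le> l * C / 2 * (\<eta> x * p)" by (simp add: mult_ac)
    have "\<eta> x * (p - 2 * n\<^sup>2) = R x - g (\<Phi> x) * D + c * (w (\<Phi> x) * (p - 2 * n\<^sup>2))"
      by (simp add: R_def D_def g'_def w_def \<eta>_def p_def n_def algebra_simps)
    hence 3: "\<eta> x * (p - 2 * n\<^sup>2) \<le> R x + l * C / 2 * (\<eta> x * p) + c * E x + 15 / l\<^sup>2 * (u x)\<^sup>2"
      using 1 2 by linarith
    have pT: "p = T x + n\<^sup>2" using T_eq[OF x] by (simp add: p_def n_def)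
    have "(1 - l * C / 2) * (\<eta> x * T x) - (1 + l * C / 2) * (\<eta> x * n\<^sup>2)
        = \<eta> x * (p - 2 * n\<^sup>2) - l * C / 2 * (\<eta> x * p)"
      unfolding pT by (simp add: field_simps)
    thus ?thesis using 3 True by (simp add: n_def)
  qed
  have "(LINT x:U|lborel. (1 - l * C / 2) * (\<eta> x * T x)) \<le> (LINT x:U|lborel. (1 + l * C / 2) * (\<eta> x * (\<nu> x \<bullet> P x)\<^sup>2)
     + 15 / l\<^sup>2 * (indicator K x * (u x)\<^sup>2) + R x + c * E x)"
    by (intro set_integral_mono set_integral_add set_integrable_mult_right iT iN iuU iR iE pw)
  also have "\<dots> = (1 + l * C / 2) * (LINT x:U|lborel. \<eta> x * (\<nu> x \<bullet> P x)\<^sup>2)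
     + 15 / l\<^sup>2 * (LINT x:K|lborel. (u x)\<^sup>2)"
    using iT iN iuU iR iE
    by (simp add: set_integral_add set_integrable_mult_right R0 E0)
  finally show "(1 - (b - a) * C / 2) * (LINT x:U|lborel. plateau k (\<tau> (\<Phi> x)) * T x)
    \<le> (1 + (b - a) * C / 2) * (LINT x:U|lborel. plateau k (\<tau> (\<Phi> x)) * (\<nu> x \<bullet> P x)\<^sup>2)
      + 15 / (b - a)\<^sup>2 * (LINT x:K|lborel. (u x)\<^sup>2)"
    by (simp add: \<eta>_def l_def)
  show "set_integrable lborel U (\<lambda>x. plateau k (\<tau> (\<Phi> x)) * T x)"
    "set_integrable lborel U (\<lambda>x. plateau k (\<tau> (\<Phi> x)) * (\<nu> x \<bullet> P x)\<^sup>2)"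
    "set_integrable lborel K (\<lambda>x. (u x)\<^sup>2)"
    using iT iN iu by (simp_all add: \<eta>_def)
qed

end

lemma set_nn_integral_eq_LINT:
  assumes "set_integrable M S f" "\<And>x. x \<in> S \<Longrightarrow> 0 \<le> f x"
  shows "(\<integral>\<^sup>+x\<in>S. ennreal (f x) \<partial>M) = ennreal (LINT x:S|M. f x)"
proof -
  have "(\<integral>\<^sup>+x\<in>S. ennreal (f x) \<partial>M) = (\<integral>\<^sup>+x. ennreal (indicator S x *\<^sub>R f x) \<partial>M)"
    by (intro nn_integral_cong) (auto simp: indicator_def)
  also have "\<dots> = ennreal (LINT x:S|M. f x)"
    unfolding set_lebesgue_integral_def using assms
    by (intro nn_integral_eq_integral) (auto simp: set_integrable_def indicator_def)
  finally show ?thesis .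
qed

lemma set_lebesgue_integral_nonneg:
  assumes "\<And>x. x \<in> S \<Longrightarrow> 0 \<le> (f x :: real)"
  shows "0 \<le> (LINT x:S|M. f x)"
  unfolding set_lebesgue_integral_def using assms by (intro integral_nonneg_AE) (auto simp: indicator_def)

text \<open>The rescaled position in the interval from \<open>s / (k + 20)\<close> to
  \<open>s - s / (k + 20)\<close> converges to a limit of modulus below 1. It is thus eventually
  below some fixed \<open>\<theta> < 1\<close> in modulus, and its growing even powers tend to 0
  although the interval varies.\<close>

lemma plateau_tendsto_1:
  fixes s t :: real
  assumes t: "0 < t" "t < s"
  shows "(\<lambda>k. plateau (Suc k) ((2 * t - s) / (s - 2 * (s / (real k + 20))))) \<longlonglongrightarrow> 1"
proof -
  define \<tau> where "\<tau> k = (2 * t - s) / (s - 2 * (s / (real k + 20)))" for k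
  have "(\<lambda>k. s / (real k + 20)) \<longlonglongrightarrow> 0"
    by (rule real_tendsto_divide_at_top[OF tendsto_const])
       (auto simp: add.commute[of _ "20::real"] intro: filterlim_tendsto_add_at_top[OF tendsto_const] filterlim_real_sequentially)
  hence "\<tau> \<longlonglongrightarrow> (2 * t - s) / (s - 2 * 0)"
    unfolding \<tau>_def using t by (intro tendsto_intros) auto
  hence lim: "(\<lambda>k. \<bar>\<tau> k\<bar>) \<longlonglongrightarrow> \<bar>(2 * t - s) / s\<bar>" by (intro tendsto_rabs) simp
  have "\<bar>(2 * t - s) / s\<bar> < 1" using t by (auto simp: abs_if field_simps)
  then obtain \<theta> where \<theta>: "\<bar>(2 * t - s) / s\<bar> < \<theta>" "\<theta> < 1" using dense by blast
  hence \<theta>0: "0 \<le> \<theta>" by (meson abs_ge_zero less_le_trans less_imp_le order.trans)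
  from order_tendstoD(2)[OF lim \<theta>(1)]
  have "\<forall>\<^sub>F k in sequentially. 1 - (\<theta>\<^sup>2) ^ Suc k \<le> plateau (Suc k) (\<tau> k)"
  proof eventually_elim
    case (elim k)
    have "\<tau> k ^ (2 * Suc k) = \<bar>\<tau> k\<bar> ^ (2 * Suc k)" by (simp add: power_even_abs)
    also have "\<dots> \<le> \<theta> ^ (2 * Suc k)" using elim by (intro power_mono) auto
    also have "\<theta> ^ (2 * Suc k) = (\<theta>\<^sup>2) ^ Suc k" by (rule power_mult)
    finally have "\<tau> k ^ (2 * Suc k) \<le> (\<theta>\<^sup>2) ^ Suc k" .
    moreover have "plateau (Suc k) (\<tau> k) = 1 - \<tau> k ^ (2 * Suc k)"
      using elim \<theta> unfolding plateau_def by auto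
    ultimately show ?case by linarith
  qed
  note low = this
  have low_lim: "(\<lambda>k. 1 - (\<theta>\<^sup>2) ^ Suc k) \<longlonglongrightarrow> 1 - 0"
    using \<theta> \<theta>0 by (intro tendsto_intros LIMSEQ_Suc LIMSEQ_power_zero) (simp add: abs_square_less_1)
  have "(\<lambda>k. plateau (Suc k) (\<tau> k)) \<longlonglongrightarrow> 1"
    by (rule tendsto_sandwich[OF low always_eventually low_lim[unfolded diff_zero] tendsto_const])
       (simp add: plateau_bounds)
  thus ?thesis by (simp add: \<tau>_def)
qed

context strip_calculus
begin

text \<open>Passage to integrals with values in \<open>[0, \<infinity>]\<close>: all cut-off
  integrals are finite, so the estimate may be divided by the factor of the normal term, and only
  then are cutoff and compact set dropped on the right. The measurability claim prepares Fatou's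
  lemma.\<close>

lemma weighted_estimate_nn:
  assumes ab: "a < b" and k: "1 \<le> k" and K: "compact {x \<in> U. a \<le> \<Phi> x \<and> \<Phi> x \<le> b}"
    and C: "\<And>x. x \<in> U \<Longrightarrow> \<bar>(norm (P x))\<^sup>2 * trA x - 2 * (A x (P x) \<bullet> P x)\<bar> \<le> C * (norm (P x))\<^sup>2"
    and \<beta>: "0 \<le> \<beta>" "0 \<le> C" "\<beta> * (1 + (b - a) * C / 2) \<le> 1 - (b - a) * C / 2"
    and M: "15 / (b - a)\<^sup>2 \<le> M"
  shows "(\<integral>\<^sup>+x\<in>U. ennreal (plateau k ((2 * \<Phi> x - a - b) / (b - a)) * (\<beta> * T x)) \<partial>lborel)
    \<le> (\<integral>\<^sup>+x\<in>U. ennreal ((\<nu> x \<bullet> P x)\<^sup>2) \<partial>lborel) + ennreal M * (\<integral>\<^sup>+x\<in>U. ennreal ((u x)\<^sup>2) \<partial>lborel)"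
    and "(\<lambda>x. ennreal (plateau k ((2 * \<Phi> x - a - b) / (b - a)) * (\<beta> * T x)) * indicator U x) \<in> borel_measurable lborel"
proof -
  let ?\<eta> = "\<lambda>x. plateau k ((2 * \<Phi> x - a - b) / (b - a))"
  let ?K = "{x \<in> U. a \<le> \<Phi> x \<and> \<Phi> x \<le> b}"
  note est = weighted_estimate[OF ab k K C]
  define X where "X = (LINT x:U|lborel. ?\<eta> x * T x)"
  define Y where "Y = (LINT x:U|lborel. ?\<eta> x * (\<nu> x \<bullet> P x)\<^sup>2)"
  define Z where "Z = (LINT x:?K|lborel. (u x)\<^sup>2)"
  have T0: "0 \<le> T x" for x by (simp add: T_def)
  have nn: "0 \<le> X" "0 \<le> Y" "0 \<le> Z"
    unfolding X_def Y_def Z_def by (intro set_lebesgue_integral_nonneg mult_nonneg_nonneg plateau_bounds T0 zero_le_power2)+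
  define e where "e = (b - a) * C / 2"
  have e: "0 \<le> e" using ab \<beta> by (simp add: e_def)
  have "(1 + e) * (\<beta> * X) = (\<beta> * (1 + e)) * X" by simp
  also have "\<dots> \<le> (1 - e) * X" using \<beta>(3) nn by (intro mult_right_mono) (simp_all add: e_def)
  also have "\<dots> \<le> (1 + e) * Y + 15 / (b - a)\<^sup>2 * Z" using est(1) by (simp add: X_def Y_def Z_def e_def)
  also have "\<dots> \<le> (1 + e) * Y + (1 + e) * (M * Z)"
  proof -
    have "15 / (b - a)\<^sup>2 * Z \<le> M * Z" using M nn by (intro mult_right_mono)
    moreover have "0 \<le> 15 / (b - a)\<^sup>2 * Z" using nn by simp
    ultimately have "15 / (b - a)\<^sup>2 * Z \<le> 1 * (M * Z)" "0 \<le> M * Z" by linarith+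
    moreover have "1 * (M * Z) \<le> (1 + e) * (M * Z)" using \<open>0 \<le> M * Z\<close> e by (intro mult_right_mono) auto
    ultimately show ?thesis by linarith
  qed
  finally have "(1 + e) * (\<beta> * X) \<le> (1 + e) * (Y + M * Z)" by (simp add: distrib_left)
  hence XYZ: "\<beta> * X \<le> Y + M * Z" by (rule mult_left_le_imp_le) (use e in simp)
  have M0: "0 \<le> M" using M by (rule order_trans[rotated]) simp
  have iT: "set_integrable lborel U (\<lambda>x. ?\<eta> x * (\<beta> * T x))"
    using set_integrable_mult_right[of \<beta>, OF est(2)] by (simp add: mult_ac)
  have "(\<integral>\<^sup>+x\<in>U. ennreal (?\<eta> x * (\<beta> * T x)) \<partial>lborel) = ennreal (LINT x:U|lborel. ?\<eta> x * (\<beta> * T x))"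
    by (intro set_nn_integral_eq_LINT iT mult_nonneg_nonneg plateau_bounds \<beta> T0)
  also have "(LINT x:U|lborel. ?\<eta> x * (\<beta> * T x)) = \<beta> * X"
    unfolding X_def set_integral_mult_right[symmetric] by (simp add: mult_ac)
  also have "ennreal (\<beta> * X) \<le> ennreal (Y + M * Z)" using XYZ by (rule ennreal_leI)
  also have "\<dots> = ennreal Y + ennreal M * ennreal Z" using nn M0 by (simp add: ennreal_plus ennreal_mult)
  also have "ennreal Y = (\<integral>\<^sup>+x\<in>U. ennreal (?\<eta> x * (\<nu> x \<bullet> P x)\<^sup>2) \<partial>lborel)"
    unfolding Y_def by (intro set_nn_integral_eq_LINT[symmetric] est(3) mult_nonneg_nonneg plateau_bounds zero_le_power2)
  also have "\<dots> \<le> (\<integral>\<^sup>+x\<in>U. ennreal ((\<nu> x \<bullet> P x)\<^sup>2) \<partial>lborel)"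
    by (intro nn_integral_mono mult_right_mono ennreal_leI mult_left_le_one_le plateau_bounds zero_le_power2) auto
  also have "ennreal Z = (\<integral>\<^sup>+x\<in>?K. ennreal ((u x)\<^sup>2) \<partial>lborel)"
    unfolding Z_def by (intro set_nn_integral_eq_LINT[symmetric] est(4) zero_le_power2)
  also have "\<dots> \<le> (\<integral>\<^sup>+x\<in>U. ennreal ((u x)\<^sup>2) \<partial>lborel)"
    by (intro nn_integral_mono) (auto simp: indicator_def)
  finally show "(\<integral>\<^sup>+x\<in>U. ennreal (?\<eta> x * (\<beta> * T x)) \<partial>lborel)
    \<le> (\<integral>\<^sup>+x\<in>U. ennreal ((\<nu> x \<bullet> P x)\<^sup>2) \<partial>lborel) + ennreal M * (\<integral>\<^sup>+x\<in>U. ennreal ((u x)\<^sup>2) \<partial>lborel)"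
    by (simp add: add_mono mult_left_mono)
  have "(\<lambda>x. ennreal (?\<eta> x * (\<beta> * T x)) * indicator U x) = (\<lambda>x. ennreal (indicator U x *\<^sub>R (?\<eta> x * (\<beta> * T x))))"
    by (auto simp: indicator_def fun_eq_iff)
  thus "(\<lambda>x. ennreal (?\<eta> x * (\<beta> * T x)) * indicator U x) \<in> borel_measurable lborel"
    using iT unfolding set_integrable_def by (simp only:) (intro measurable_compose[OF _ measurable_ennreal] borel_measurable_integrable)
qed

text \<open>The intervals \<open>[a k, s - a k]\<close> exhaust the strip while the exponent of the
  plateau grows with the same index \<open>k\<close>. The right side does not depend on
  \<open>k\<close>, so Fatou's lemma removes the cutoff on the left.\<close>

lemma strip_estimate:
  assumes \<Phi>s: "\<And>x. x \<in> U \<Longrightarrow> 0 < \<Phi> x \<and> \<Phi> x < s" and s: "0 < s"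
    and K: "\<And>a b. 0 < a \<Longrightarrow> b < s \<Longrightarrow> compact {x \<in> U. a \<le> \<Phi> x \<and> \<Phi> x \<le> b}"
    and C: "\<And>x. x \<in> U \<Longrightarrow> \<bar>(norm (P x))\<^sup>2 * trA x - 2 * (A x (P x) \<bullet> P x)\<bar> \<le> C * (norm (P x))\<^sup>2"
    and \<beta>: "0 \<le> \<beta>" "0 \<le> C" "\<beta> * (1 + s * C / 2) \<le> 1 - s * C / 2"
  shows "(\<integral>\<^sup>+x\<in>U. ennreal (\<beta> * T x) \<partial>lborel)
    \<le> (\<integral>\<^sup>+x\<in>U. ennreal ((\<nu> x \<bullet> P x)\<^sup>2) \<partial>lborel) + ennreal (24 / s\<^sup>2) * (\<integral>\<^sup>+x\<in>U. ennreal ((u x)\<^sup>2) \<partial>lborel)"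
    (is "_ \<le> ?R")
proof -
  \<comment> \<open>The offset 20 keeps every interval at least \<open>9 / 10 * s\<close> long, and
    15 divided by the square of \<open>9 / 10\<close> is below 24.\<close>
  define a where "a k = s / (real k + 20)" for k
  have a: "0 < a k" "20 * a k \<le> s" for k using s by (auto simp: a_def field_simps)
  define f where "f k x = ennreal (plateau (Suc k) ((2 * \<Phi> x - a k - (s - a k)) / (s - a k - a k)) * (\<beta> * T x)) * indicator U x" for k x
  have len: "s - a k - a k \<le> s" "9 / 10 * s \<le> s - a k - a k" for k using a[of k] by linarith+
  have \<beta>': "\<beta> * (1 + (s - a k - a k) * C / 2) \<le> 1 - (s - a k - a k) * C / 2" for k
  proof -
    have lC: "(s - a k - a k) * C \<le> s * C" using len(1) \<beta>(2) by (rule mult_right_mono)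
    hence "\<beta> * (1 + (s - a k - a k) * C / 2) \<le> \<beta> * (1 + s * C / 2)" using \<beta>(1) by (intro mult_left_mono) auto
    thus ?thesis using \<beta>(3) lC by linarith
  qed
  have M: "15 / (s - a k - a k)\<^sup>2 \<le> 24 / s\<^sup>2" for k
  proof -
    have "15 / (s - a k - a k)\<^sup>2 \<le> 15 / (9 / 10 * s)\<^sup>2"
      using len(2)[of k] s by (intro divide_left_mono power_mono mult_pos_pos zero_less_power) auto
    also have "\<dots> \<le> 24 / s\<^sup>2" using s by (simp add: power2_eq_square field_simps)
    finally show ?thesis .
  qed
  have bnd: "(\<integral>\<^sup>+x. f k x \<partial>lborel) \<le> ?R" and meas: "f k \<in> borel_measurable lborel" for k
  proof -
    have ab: "a k < s - a k" "s - a k < s" using a[of k] s by linarith+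
    have "1 \<le> Suc k" by simp
    note est = weighted_estimate_nn[OF ab(1) this K[OF a(1) ab(2)] C \<beta>(1,2) \<beta>' M]
    show "(\<integral>\<^sup>+x. f k x \<partial>lborel) \<le> ?R" "f k \<in> borel_measurable lborel"
      using est unfolding f_def by blast+
  qed
  have lim: "liminf (\<lambda>k. f k x) = ennreal (\<beta> * T x) * indicator U x" for x
  proof (cases "x \<in> U")
    case True
    have "(\<lambda>k. plateau (Suc k) ((2 * \<Phi> x - s) / (s - 2 * (s / (real k + 20)))) * (\<beta> * T x)) \<longlonglongrightarrow> 1 * (\<beta> * T x)"
      using \<Phi>s[OF True] by (intro tendsto_mult tendsto_const plateau_tendsto_1) auto
    hence "(\<lambda>k. f k x) \<longlonglongrightarrow> ennreal (\<beta> * T x)"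
      using True by (auto simp: f_def a_def algebra_simps intro: tendsto_ennrealI)
    thus ?thesis using True by (simp add: lim_imp_Liminf)
  next
    case False
    thus ?thesis by (simp add: f_def Liminf_const)
  qed
  have "(\<integral>\<^sup>+x\<in>U. ennreal (\<beta> * T x) \<partial>lborel) = (\<integral>\<^sup>+x. liminf (\<lambda>k. f k x) \<partial>lborel)"
    by (simp add: lim)
  also have "\<dots> \<le> liminf (\<lambda>k. \<integral>\<^sup>+x. f k x \<partial>lborel)" by (rule nn_integral_liminf) (rule meas)
  also have "\<dots> \<le> limsup (\<lambda>k. \<integral>\<^sup>+x. f k x \<partial>lborel)" by (rule Liminf_le_Limsup) simp
  also have "\<dots> \<le> ?R" by (rule Limsup_bounded) (simp add: bnd)
  finally show ?thesis .
qed

end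

section \<open>The estimate on the strip\<close>

text \<open>Components of an open set are open, so \<open>p0\<close> is constant near
  \<open>x\<close> and does not affect the derivative.\<close>

lemma has_derivative_diff_locally_constant:
  fixes p p0 :: "'a::euclidean_space \<Rightarrow> real"
  assumes "open U" "x \<in> U" "(p has_derivative p') (at x)"
    and const: "\<forall>C\<in>components U. \<exists>c. \<forall>x\<in>C. p0 x = c"
  shows "((\<lambda>x. p x - p0 x) has_derivative p') (at x)"
proof -
  define C where "C = connected_component_set U x"
  have C: "C \<in> components U" "x \<in> C" "open C"
    using assms(1,2) by (auto simp: C_def componentsI open_connected_component)
  then obtain c where c: "\<And>y. y \<in> C \<Longrightarrow> p0 y = c" using const by blast
  have "((\<lambda>x. p x - c) has_derivative p') (at x)"
    using has_derivative_diff[OF assms(3) has_derivative_const[of c]] by simp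
  thus ?thesis
    by (rule has_derivative_transform_within_open[OF _ C(3,2)]) (simp add: c)
qed

text \<open>The trace contributes one \<open>M\<close> for each dimension and the quadratic term
  another two.\<close>

lemma curvature_term_bound:
  fixes A :: "'a::euclidean_space \<Rightarrow> 'a"
  assumes "\<And>v. \<bar>A v \<bullet> v\<bar> \<le> M * (norm v)\<^sup>2"
  shows "\<bar>(norm w)\<^sup>2 * (\<Sum>b\<in>Basis. A b \<bullet> b) - 2 * (A w \<bullet> w)\<bar> \<le> (real DIM('a) + 2) * M * (norm w)\<^sup>2"
proof -
  have "\<bar>\<Sum>b\<in>Basis. A b \<bullet> b\<bar> \<le> (\<Sum>b\<in>(Basis::'a set). M)"
    by (rule order_trans[OF sum_abs]) (intro sum_mono order_trans[OF assms], simp)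
  hence "\<bar>(norm w)\<^sup>2 * (\<Sum>b\<in>Basis. A b \<bullet> b)\<bar> \<le> (norm w)\<^sup>2 * (real DIM('a) * M)"
    unfolding abs_mult by (intro mult_mono) auto
  moreover have "\<bar>2 * (A w \<bullet> w)\<bar> \<le> 2 * (M * (norm w)\<^sup>2)" using assms[of w] by (simp add: abs_mult)
  ultimately show ?thesis by (simp add: algebra_simps)
qed

text \<open>The distance is zero on the frontier, so \<open>0 < a\<close> excludes frontier points
  and the set is closed in the whole space.\<close>

lemma compact_between_level_sets:
  fixes \<Omega> :: "'a::euclidean_space set"
  assumes "open \<Omega>" "bounded \<Omega>" "0 < a" "b < s"
  shows "compact {x \<in> strip \<Omega> s. a \<le> bdist \<Omega> x \<and> bdist \<Omega> x \<le> b}"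
proof -
  have cont: "continuous_on UNIV (bdist \<Omega>)"
    unfolding bdist_def[abs_def] by (intro continuous_intros)
  have "closed (closure \<Omega> \<inter> ({x. a \<le> bdist \<Omega> x} \<inter> {x. bdist \<Omega> x \<le> b}))"
    using cont by (intro closed_Int closed_Collect_le closed_closure continuous_intros)
  moreover have "bounded (closure \<Omega> \<inter> ({x. a \<le> bdist \<Omega> x} \<inter> {x. bdist \<Omega> x \<le> b}))"
    using assms(2) by (intro bounded_Int) auto
  moreover have "closure \<Omega> \<inter> ({x. a \<le> bdist \<Omega> x} \<inter> {x. bdist \<Omega> x \<le> b})
      = {x \<in> strip \<Omega> s. a \<le> bdist \<Omega> x \<and> bdist \<Omega> x \<le> b}"
  proof -
    have "x \<in> \<Omega>" if "x \<in> closure \<Omega>" "a \<le> bdist \<Omega> x" for x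
    proof (rule ccontr)
      assume "x \<notin> \<Omega>"
      hence "x \<in> frontier \<Omega>" using that(1) \<open>open \<Omega>\<close> by (simp add: frontier_def interior_open)
      hence "bdist \<Omega> x = 0" by (simp add: bdist_def)
      thus False using that(2) \<open>0 < a\<close> by simp
    qed
    thus ?thesis using \<open>b < s\<close> closure_subset by (fastforce simp: strip_def)
  qed
  ultimately show ?thesis by (simp add: compact_eq_bounded_closed)
qed

theorem theorem2p1:
  fixes \<Omega> :: "'a::euclidean_space set" and s0 \<beta>1 :: real
  assumes "DIM('a) \<ge> 2"
    and "open \<Omega>" and "connected \<Omega>" and "bounded \<Omega>" and "\<Omega> \<noteq> {}"
    and "Ck_boundary 3 \<Omega>"
    and "s0 > 0"
    and "Ck_on 3 (strip \<Omega> s0) (bdist \<Omega>)"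
    and "\<forall>x\<in>strip \<Omega> s0. norm (grad (bdist \<Omega>) x) = 1"
    and "\<beta>1 < 1"
  shows "\<exists>s1. 0 < s1 \<and> s1 < s0 \<and>
    (\<forall>s p p0. 0 < s \<and> s < s1 \<and> harmonic_on (strip \<Omega> s) p \<and>
       (\<forall>C\<in>components (strip \<Omega> s). \<exists>c. \<forall>x\<in>C. p0 x = c) \<longrightarrow>
       ennreal \<beta>1 * (\<integral>\<^sup>+ x \<in> strip \<Omega> s.
            ennreal ((norm (grad p x - (nvec \<Omega> x \<bullet> grad p x) *\<^sub>R nvec \<Omega> x))\<^sup>2) \<partial>lebesgue)
       \<le> (\<integral>\<^sup>+ x \<in> strip \<Omega> s. ennreal ((nvec \<Omega> x \<bullet> grad p x)\<^sup>2) \<partial>lebesgue)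
         + ennreal (24 / s\<^sup>2) * (\<integral>\<^sup>+ x \<in> strip \<Omega> s. ennreal ((p x - p0 x)\<^sup>2) \<partial>lebesgue))"
proof -
  \<comment> \<open>Otherwise \<open>\<Omega>\<close> would be open and closed, hence the whole
    space, which is unbounded.\<close>
  have ne: "frontier \<Omega> \<noteq> {}"
    using frontier_eq_empty[of \<Omega>] \<open>\<Omega> \<noteq> {}\<close> \<open>bounded \<Omega>\<close> not_bounded_UNIV by blast
  obtain r where r: "0 < r" "\<And>q. q \<in> frontier \<Omega> \<Longrightarrow> \<exists>e. norm e = 1 \<and>
      ball (q + r *\<^sub>R e) r \<inter> \<Omega> = {} \<and> ball (q - r *\<^sub>R e) r \<subseteq> \<Omega>"
    using uniform_tangent_balls[OF \<open>open \<Omega>\<close> \<open>bounded \<Omega>\<close> \<open>Ck_boundary 3 \<Omega>\<close>] by metis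
  \<comment> \<open>As \<open>ennreal\<close> sends negative numbers to 0, replacing
    \<open>\<beta>1\<close> by its positive part leaves the left side unchanged.\<close>
  define \<beta> where "\<beta> = max \<beta>1 0"
  define C where "C = (real DIM('a) + 2) * (2 / r)"
  have \<beta>: "0 \<le> \<beta>" "\<beta> < 1" using \<open>\<beta>1 < 1\<close> by (auto simp: \<beta>_def)
  have C: "0 < C" using r by (simp add: C_def add_nonneg_pos)
  \<comment> \<open>For \<open>s \<le> d\<close> the curvature error satisfies
    \<open>s * C \<le> 1 - \<beta>\<close>, which yields the smallness condition of
    \<open>strip_estimate\<close>.\<close>
  define d where "d = (1 - \<beta>) / C"
  have d: "0 < d" using \<beta> C by (simp add: d_def)
  \<comment> \<open>The three bounds ensure \<open>s1 < s0\<close>, the validity of the Hessian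
    bound on the strip, and a small curvature error.\<close>
  define s1 where "s1 = min (s0 / 2) (min (r / 2) d)"
  have s1: "0 < s1" "s1 < s0" "s1 \<le> r / 2" "s1 \<le> d"
    unfolding s1_def min_less_iff_conj min_le_iff_disj using \<open>s0 > 0\<close> r(1) d by simp_all
  have openS: "open (strip \<Omega> s)" for s
  proof -
    have "continuous_on UNIV (bdist \<Omega>)"
      unfolding bdist_def[abs_def] by (intro continuous_intros)
    hence "open (\<Omega> \<inter> {x. bdist \<Omega> x < s})"
      using \<open>open \<Omega>\<close> by (intro open_Int open_Collect_less continuous_intros)
    thus ?thesis by (simp add: strip_def Collect_conj_eq)
  qed
  have main: "ennreal \<beta>1 * (\<integral>\<^sup>+ x \<in> strip \<Omega> s.
            ennreal ((norm (grad p x - (nvec \<Omega> x \<bullet> grad p x) *\<^sub>R nvec \<Omega> x))\<^sup>2) \<partial>lebesgue)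
       \<le> (\<integral>\<^sup>+ x \<in> strip \<Omega> s. ennreal ((nvec \<Omega> x \<bullet> grad p x)\<^sup>2) \<partial>lebesgue)
         + ennreal (24 / s\<^sup>2) * (\<integral>\<^sup>+ x \<in> strip \<Omega> s. ennreal ((p x - p0 x)\<^sup>2) \<partial>lebesgue)"
    if s: "0 < s" "s < s1" and p: "harmonic_on (strip \<Omega> s) p"
      and p0: "\<forall>C\<in>components (strip \<Omega> s). \<exists>c. \<forall>x\<in>C. p0 x = c" for s p p0
  proof -
    let ?U = "strip \<Omega> s"
    have sub: "?U \<subseteq> strip \<Omega> s0" "?U \<subseteq> strip \<Omega> (r / 2)" using s s1 by (auto simp: strip_def)
    have \<Phi>2: "Ck_on 2 ?U (bdist \<Omega>)"
      by (rule Ck_on_subset[OF Ck_on_3_imp_2[OF \<open>Ck_on 3 (strip \<Omega> s0) (bdist \<Omega>)\<close>] sub(1)])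
    have p2: "Ck_on 2 ?U p" and lap: "\<And>x. x \<in> ?U \<Longrightarrow> laplacian p x = 0"
      using p by (auto simp: harmonic_on_def)
    interpret strip_calculus ?U "bdist \<Omega>" "grad (bdist \<Omega>)" "hess (bdist \<Omega>)"
      "\<lambda>x. p x - p0 x" "grad p" "hess p"
    proof
      show "((\<lambda>x. p x - p0 x) has_derivative (\<lambda>h. grad p x \<bullet> h)) (at x)" if "x \<in> ?U" for x
        by (rule has_derivative_diff_locally_constant[OF openS that Ck2_deriv[OF openS p2 that] p0])
      show "norm (grad (bdist \<Omega>) x) = 1" if "x \<in> ?U" for x
        using that sub \<open>\<forall>x\<in>strip \<Omega> s0. norm (grad (bdist \<Omega>) x) = 1\<close> by blast
      show "(\<Sum>b\<in>Basis. hess p x b \<bullet> b) = 0" if "x \<in> ?U" for x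
        using lap[OF that] by (simp add: laplacian_hess[OF openS p2])
    qed (fact openS Ck2_deriv[OF openS \<Phi>2] Ck2_grad_deriv[OF openS \<Phi>2] Ck2_hess_cont[OF openS \<Phi>2]
        Ck2_grad_deriv[OF openS p2] Ck2_hess_cont[OF openS p2] Ck2_hess_symmetric[OF openS p2])+
    have curv: "\<bar>hess (bdist \<Omega>) x v \<bullet> v\<bar> \<le> 2 / r * (norm v)\<^sup>2" if "x \<in> ?U" for x v
      by (rule bdist_hessian_bound[OF \<open>open \<Omega>\<close> ne r openS sub(2) that \<Phi> \<nu>[OF that]])
    have est: "(\<integral>\<^sup>+x\<in>?U. ennreal (\<beta> * T x) \<partial>lborel)
      \<le> (\<integral>\<^sup>+x\<in>?U. ennreal ((grad (bdist \<Omega>) x \<bullet> grad p x)\<^sup>2) \<partial>lborel)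
        + ennreal (24 / s\<^sup>2) * (\<integral>\<^sup>+x\<in>?U. ennreal ((p x - p0 x)\<^sup>2) \<partial>lborel)"
    proof (rule strip_estimate[where C = C])
      show "0 < bdist \<Omega> x \<and> bdist \<Omega> x < s" if "x \<in> ?U" for x
      proof -
        have "x \<notin> frontier \<Omega>" using that \<open>open \<Omega>\<close> by (auto simp: strip_def frontier_def interior_open)
        hence "0 < infdist x (frontier \<Omega>)" by (intro infdist_pos_not_in_closed frontier_closed ne)
        thus ?thesis using that by (simp add: strip_def bdist_def)
      qed
      show "compact {x \<in> ?U. a \<le> bdist \<Omega> x \<and> bdist \<Omega> x \<le> b}" if "0 < a" "b < s" for a b
        by (rule compact_between_level_sets[OF \<open>open \<Omega>\<close> \<open>bounded \<Omega>\<close> that])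
      show "\<bar>(norm (grad p x))\<^sup>2 * trA x - 2 * (hess (bdist \<Omega>) x (grad p x) \<bullet> grad p x)\<bar>
          \<le> C * (norm (grad p x))\<^sup>2" if "x \<in> ?U" for x
        using curvature_term_bound[of "hess (bdist \<Omega>) x" "2 / r" "grad p x"] curv[OF that]
        unfolding trA_def C_def by blast
      have "s * C \<le> d * C" using s s1(4) C by (intro mult_right_mono) auto
      hence "s * C \<le> 1 - \<beta>" using C by (simp add: d_def)
      moreover have "\<beta> * (s * C) \<le> s * C" using \<beta> s C by (intro mult_left_le_one_le) auto
      ultimately show "\<beta> * (1 + s * C / 2) \<le> 1 - s * C / 2" by (simp add: algebra_simps)
    qed (use s \<beta> C in auto)
    have "ennreal \<beta>1 = ennreal \<beta>" by (auto simp: \<beta>_def max_def ennreal_neg)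
    \<comment> \<open>Moving the constant into the integral uses measurability, which comes from the
      continuity of \<open>T\<close> on the open strip.\<close>
    moreover have "ennreal \<beta> * (\<integral>\<^sup>+x\<in>?U. ennreal (T x) \<partial>lborel) = (\<integral>\<^sup>+x\<in>?U. ennreal (\<beta> * T x) \<partial>lborel)"
    proof -
      have "(\<lambda>x. indicator ?U x *\<^sub>R T x) \<in> borel_measurable borel"
        using openS cont_T by (intro borel_measurable_continuous_on_indicator) auto
      hence "(\<lambda>x. ennreal (indicator ?U x *\<^sub>R T x)) \<in> borel_measurable lborel" by measurable
      moreover have "(\<lambda>x. ennreal (indicator ?U x *\<^sub>R T x)) = (\<lambda>x. ennreal (T x) * indicator ?U x)"
        by (auto simp: indicator_def fun_eq_iff)
      ultimately have "(\<lambda>x. ennreal (T x) * indicator ?U x) \<in> borel_measurable lborel" by simp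
      from nn_integral_cmult[OF this, of "ennreal \<beta>"] show ?thesis
        using \<beta> by (simp add: ennreal_mult' mult.assoc)
    qed
    \<comment> \<open>Nonnegative integrals agree for \<open>lborel\<close> and its completion
      \<open>lebesgue\<close>; the opposite sign of \<open>nvec\<close> cancels in both quadratic
      expressions.\<close>
    ultimately show ?thesis
      using est by (simp add: nn_integral_completion nvec_def T_def[abs_def])
  qed
  show ?thesis using s1 main by blast
qed

end
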